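(* For every positive integer $k$, there exists an extremal Type~II $\mathbb{Z}_{2k}$-code of length $32$, and there exists an extremal Type~II $\mathbb{Z}_{2k}$-code of length $40$.
   Context: $\mathbb{Z}_m$ denotes the ring of integers modulo $m$. A $\mathbb{Z}_m$-code of length $n$ is a $\mathbb{Z}_m$-submodule of $\mathbb{Z}_m^n$; it is self-dual if $C=C^\perp$, where $C^\perp=\{x\in\mathbb{Z}_m^n : x\cdot y=0 \text{ for all } y\in C\}$ with respect to the standard inner product. The Euclidean weight of $x=(x_1,\dots,x_n)\in\mathbb{Z}_m^n$ is $\sum_{\alpha=1}^{\lfloor m/2\rfloor} n_\alpha(x)\alpha^2$, where $n_\alpha(x)$ is the number of $i$ with $x_i\equiv\pm\alpha \pmod m$; $d_E(C)$ is the minimum Euclidean weight of a nonzero codeword of $C$. A Type~II $\mathbb{Z}_{2k}$-code is a self-dual $\mathbb{Z}_{2k}$-code all of whose codewords have Euclidean weight divisible by $4k$. For a Type~II $\mathbb{Z}_{2k}$-code $C$ of length $n\le 136$ one has $d_E(C)\le 4k\lfloor n/24\rfloor+4k$, and $C$ is called extremal if equality holds. *)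

theory Defs
  imports Main
begin

text \<open>Vectors of Z_m^n are represented as functions nat => int whose entries at
positions i < n are canonical residues in {0..m-1} and which vanish outside {0..<n}.
Addition and scalar multiplication are componentwise, reduced mod m.\<close>

definition zvecs :: "nat \<Rightarrow> nat \<Rightarrow> (nat \<Rightarrow> int) set" where
  "zvecs m n = {x. (\<forall>i<n. 0 \<le> x i \<and> x i < int m) \<and> (\<forall>i. n \<le> i \<longrightarrow> x i = 0)}"

definition zadd :: "nat \<Rightarrow> nat \<Rightarrow> (nat \<Rightarrow> int) \<Rightarrow> (nat \<Rightarrow> int) \<Rightarrow> (nat \<Rightarrow> int)" where
  "zadd m n x y = (\<lambda>i. if i < n then (x i + y i) mod int m else 0)"

definition zsmult :: "nat \<Rightarrow> nat \<Rightarrow> int \<Rightarrow> (nat \<Rightarrow> int) \<Rightarrow> (nat \<Rightarrow> int)" where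
  "zsmult m n a x = (\<lambda>i. if i < n then (a * x i) mod int m else 0)"

definition zcode :: "nat \<Rightarrow> nat \<Rightarrow> (nat \<Rightarrow> int) set \<Rightarrow> bool" where
  "zcode m n C \<longleftrightarrow> C \<subseteq> zvecs m n \<and> (\<lambda>_. 0) \<in> C \<and>
     (\<forall>x\<in>C. \<forall>y\<in>C. zadd m n x y \<in> C) \<and> (\<forall>a. \<forall>x\<in>C. zsmult m n a x \<in> C)"

definition zdual :: "nat \<Rightarrow> nat \<Rightarrow> (nat \<Rightarrow> int) set \<Rightarrow> (nat \<Rightarrow> int) set" where
  "zdual m n C = {x \<in> zvecs m n. \<forall>y\<in>C. (\<Sum>i<n. x i * y i) mod int m = 0}"

definition self_dual :: "nat \<Rightarrow> nat \<Rightarrow> (nat \<Rightarrow> int) set \<Rightarrow> bool" where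
  "self_dual m n C \<longleftrightarrow> zcode m n C \<and> C = zdual m n C"

definition n_alpha :: "nat \<Rightarrow> nat \<Rightarrow> nat \<Rightarrow> (nat \<Rightarrow> int) \<Rightarrow> nat" where
  "n_alpha m n \<alpha> x = card {i. i < n \<and> (x i mod int m = int \<alpha> mod int m \<or> x i mod int m = (- int \<alpha>) mod int m)}"

definition euclid_wt :: "nat \<Rightarrow> nat \<Rightarrow> (nat \<Rightarrow> int) \<Rightarrow> nat" where
  "euclid_wt m n x = (\<Sum>\<alpha>=1..m div 2. n_alpha m n \<alpha> x * \<alpha>\<^sup>2)"

definition min_euclid :: "nat \<Rightarrow> nat \<Rightarrow> (nat \<Rightarrow> int) set \<Rightarrow> nat" where
  "min_euclid m n C = Min {euclid_wt m n x | x. x \<in> C \<and> x \<noteq> (\<lambda>_. 0)}"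

definition type_II :: "nat \<Rightarrow> nat \<Rightarrow> (nat \<Rightarrow> int) set \<Rightarrow> bool" where
  "type_II k n C \<longleftrightarrow> self_dual (2*k) n C \<and> (\<forall>x\<in>C. 4*k dvd euclid_wt (2*k) n x)"

definition extremal_type_II :: "nat \<Rightarrow> nat \<Rightarrow> (nat \<Rightarrow> int) set \<Rightarrow> bool" where
  "extremal_type_II k n C \<longleftrightarrow> type_II k n C \<and>
     min_euclid (2*k) n C = 4*k*(n div 24) + 4*k"

end

theory Submission
  imports Defs "HOL-Computational_Algebra.Primes"
begin

text \<open>
For length 2h with h = 16 or h = 20 we use an integer matrix T of order h with entries 0, 1, -1 and
T T^t = 7 I, which is built from 4 by 4 blocks of right multiplications by quaternions.
The binary code generated by [I | T] is doubly even, self-dual and has minimum weight 8; this settles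
k = 1. Doubling the density of its construction B lattice, as for the Leech lattice, gives an even
unimodular lattice of minimum norm 4. Extremal Type II codes over Z_2k, for k at least 2, correspond to
frames of 2h pairwise orthogonal vectors of norm 2k in such a lattice.

Left multiplication L_q by a quaternion q commutes with T, so the matrix with block rows
(L_q, T) and (- T^t, L_q^t) has orthogonal rows of length |q|^2 + 7. If the real part of q is odd and
the other components are even, then its rows are, up to scaling, lattice vectors, subject to a parity
condition which can be met by changing the sign of the real part. As 4k - 7 = 4(k - 2) + 1 is a sum of
four squares, exactly one of which is odd, a frame of norm 2k exists for every k \<ge> 2.
\<close>

section \<open>Sums of four squares\<close>

text \<open>The constant 7 is forced from two sides. A row of [I | T] has weight 1 + 7 = 8, the
  minimum weight required for k = 1. A frame vector is twice a row of length 4k, hence has norm 2k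
  when x\<cdot>x is divided by 8, and this leaves |q|^2 = 4k - 7, which is 1 modulo 4. After
  reordering, L_q is therefore congruent to I modulo 2, and the rows of the frame reduce to
  codewords of [I | T] and [T^t | I].

  For both lengths the floor of n/24 is 1, so the target is 8k. In frame coordinates a codeword has
  Euclidean weight 2k times the norm of a lattice vector; evenness of the lattice gives divisibility
  by 4k, and minimum norm 4 gives 8k. The case k = 1 must be separate: a lattice of minimum norm 4
  has no vectors of norm 2, and accordingly 4k - 7 is negative.

  The density is doubled by adjoining a vector w with odd entries. Its norm must be even, that is,
  16 must divide w\<cdot>w. The all-one vector satisfies this at length 32 but not at length 40, so
  w is kept as a parameter, and it also takes the place of the all-one vector in the condition of
  construction B.\<close>

definition four_squares :: "int \<Rightarrow> bool" where
  "four_squares n \<longleftrightarrow> (\<exists>a b c d. n = a\<^sup>2 + b\<^sup>2 + c\<^sup>2 + d\<^sup>2)"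

text \<open>Euler's identity. The four terms are the components of the second quaternion times the
  conjugate of the first, and the quaternion norm is multiplicative.\<close>

lemma four_squares_mult:
  assumes "four_squares m" "four_squares n"
  shows "four_squares (m * n)"
proof -
  obtain a b c d where m: "m = a\<^sup>2 + b\<^sup>2 + c\<^sup>2 + d\<^sup>2"
    using assms(1) unfolding four_squares_def by blast
  obtain x y z u where n: "n = x\<^sup>2 + y\<^sup>2 + z\<^sup>2 + u\<^sup>2"
    using assms(2) unfolding four_squares_def by blast
  have "m * n = (a*x + b*y + c*z + d*u)\<^sup>2 + (a*y - b*x + c*u - d*z)\<^sup>2
      + (a*z - c*x + d*y - b*u)\<^sup>2 + (a*u - d*x + b*z - c*y)\<^sup>2"
    unfolding m n by (simp add: power2_eq_square algebra_simps)
  then show ?thesis unfolding four_squares_def by blast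
qed

section \<open>Lagrange's four-square theorem by descent\<close>

lemma centered_residue:
  fixes x m :: int
  assumes "m > 0"
  obtains y where "m dvd x - y" "2 * \<bar>y\<bar> \<le> m"
proof (cases "2 * (x mod m) \<le> m")
  case True
  show ?thesis
    using that[of "x mod m"] True assms by (simp add: minus_mod_eq_mult_div)
next
  case False
  have "m dvd x - (x mod m - m)"
    by (metis diff_diff_eq2 dvd_add dvd_minus_mod dvd_refl add.commute add_diff_eq)
  moreover have "x mod m < m" using assms by simp
  ultimately show ?thesis
    using that[of "x mod m - m"] False by simp
qed

lemma square_le_of_centered:
  fixes y m :: int
  assumes "2 * \<bar>y\<bar> \<le> m"
  shows "4 * y\<^sup>2 \<le> m\<^sup>2"
proof -
  have "(2 * \<bar>y\<bar>)\<^sup>2 \<le> m\<^sup>2" using assms by (intro power_mono) auto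
  then show ?thesis by (simp add: power_mult_distrib)
qed

text \<open>Pigeonhole: on 0, ..., (p - 1)/2 the squares are distinct modulo p, and so are the
  values -1 - y^2. These are p + 1 residues in total, so some x^2 and -1 - y^2 coincide.\<close>

lemma prime_dvd_sum_two_squares_add_one:
  fixes p :: int
  assumes "prime p" "odd p"
  obtains x y :: int where "p dvd x\<^sup>2 + y\<^sup>2 + 1" "2 * \<bar>x\<bar> < p" "2 * \<bar>y\<bar> < p"
proof -
  define s where "s = (p - 1) div 2"
  have ps: "p = 2 * s + 1" using assms(2) unfolding s_def by presburger
  have p1: "p > 1" using assms(1) prime_gt_1_int by blast
  define f where "f = (\<lambda>x::int. x\<^sup>2 mod p)"
  define g where "g = (\<lambda>x::int. (- 1 - x\<^sup>2) mod p)"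
  have same: "x = y" if "x \<in> {0..s}" "y \<in> {0..s}" "p dvd x\<^sup>2 - y\<^sup>2" for x y
  proof -
    have "p dvd (x - y) * (x + y)" using that(3) by (simp add: power2_eq_square algebra_simps)
    then have "p dvd x - y \<or> p dvd x + y" using assms(1) by (simp add: prime_dvd_mult_iff)
    moreover have "\<bar>x - y\<bar> < p" "\<bar>x + y\<bar> < p" using that ps by auto
    ultimately have "x - y = 0 \<or> x + y = 0"
      using zdvd_not_zless by (meson dvd_imp_le_int linorder_not_le abs_ge_self order.strict_trans1 abs_of_pos p1 order.strict_trans zero_less_one dvd_imp_le_int)
    then show ?thesis using that by auto
  qed
  have f: "inj_on f {0..s}"
    by (rule inj_onI, rule same, auto simp: f_def mod_eq_dvd_iff)
  have g: "inj_on g {0..s}"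
  proof (rule inj_onI)
    fix x y assume a: "x \<in> {0..s}" "y \<in> {0..s}" "g x = g y"
    then have "p dvd y\<^sup>2 - x\<^sup>2" by (auto simp: g_def mod_eq_dvd_iff)
    then show "x = y" using same a by metis
  qed
  have "f ` {0..s} \<inter> g ` {0..s} \<noteq> {}"
  proof
    assume e: "f ` {0..s} \<inter> g ` {0..s} = {}"
    have "card (f ` {0..s} \<union> g ` {0..s}) = nat (s + 1) + nat (s + 1)"
      using card_image[OF f] card_image[OF g] e by (subst card_Un_disjoint) auto
    moreover have "card (f ` {0..s} \<union> g ` {0..s}) \<le> card {0..<p}"
      using p1 by (intro card_mono) (auto simp: f_def g_def)
    ultimately show False using ps p1 by simp
  qed
  then obtain x y where xy: "x \<in> {0..s}" "y \<in> {0..s}" "f x = g y" by blast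
  have "p dvd x\<^sup>2 + y\<^sup>2 + 1"
    using xy(3) by (simp add: f_def g_def mod_eq_dvd_iff algebra_simps)
  then show ?thesis using that[of x y] xy ps by auto
qed

text \<open>Reducing the four roots modulo m to centred residues gives a sum of squares
  \<open>S = m * r\<close> with r at most m. Euler's identity for (m p)(m r) produces four
  components that are all divisible by m; dividing by m^2 represents r p. The extreme values r = 0
  and r = m are excluded since each would make m divide p.\<close>

lemma four_squares_descent:
  fixes p m :: int
  assumes p: "prime p" and m: "1 < m" "m < p" and mp: "four_squares (m * p)"
  obtains r where "0 < r" "r < m" "four_squares (r * p)"
proof -
  obtain a b c d where abcd: "m * p = a\<^sup>2 + b\<^sup>2 + c\<^sup>2 + d\<^sup>2"
    using mp unfolding four_squares_def by blast
  have m0: "m > 0" using m by simp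
  obtain a' where a': "m dvd a - a'" "2 * \<bar>a'\<bar> \<le> m" using centered_residue[OF m0] .
  obtain b' where b': "m dvd b - b'" "2 * \<bar>b'\<bar> \<le> m" using centered_residue[OF m0] .
  obtain c' where c': "m dvd c - c'" "2 * \<bar>c'\<bar> \<le> m" using centered_residue[OF m0] .
  obtain d' where d': "m dvd d - d'" "2 * \<bar>d'\<bar> \<le> m" using centered_residue[OF m0] .
  obtain ta tb tc td where t: "a = a' + m * ta" "b = b' + m * tb" "c = c' + m * tc" "d = d' + m * td"
    using a'(1) b'(1) c'(1) d'(1) unfolding dvd_def by (metis add.commute diff_add_cancel)
  define S where "S = a'\<^sup>2 + b'\<^sup>2 + c'\<^sup>2 + d'\<^sup>2"
  have S_expand: "m * p = S + m * (2 * (a' * ta + b' * tb + c' * tc + d' * td))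
      + m\<^sup>2 * (ta\<^sup>2 + tb\<^sup>2 + tc\<^sup>2 + td\<^sup>2)"
    unfolding abcd t S_def by (simp add: power2_eq_square algebra_simps)
  have "S = m * (p - 2 * (a' * ta + b' * tb + c' * tc + d' * td) - m * (ta\<^sup>2 + tb\<^sup>2 + tc\<^sup>2 + td\<^sup>2))"
    using S_expand by (simp add: power2_eq_square algebra_simps)
  then obtain r where r: "S = m * r" by blast
  have not_dvd: "\<not> m dvd p"
    using p m by (metis prime_int_iff less_irrefl m0 order.strict_iff_order zero_le_one order.strict_trans)
  have sq: "4 * a'\<^sup>2 \<le> m\<^sup>2" "4 * b'\<^sup>2 \<le> m\<^sup>2" "4 * c'\<^sup>2 \<le> m\<^sup>2" "4 * d'\<^sup>2 \<le> m\<^sup>2"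
    using a' b' c' d' square_le_of_centered by auto
  have "m * r \<le> m * m" using sq r unfolding S_def power2_eq_square by linarith
  then have "r \<le> m" using m0 by simp
  \<comment> \<open>Equality forces every centred residue to be m/2 in absolute value. The doubled
    cross terms are then divisible by m, so m^2 divides m p.\<close>
  moreover have "r \<noteq> m"
  proof
    assume "r = m"
    then have "S = m * m" using r by simp
    then have "4 * a'\<^sup>2 = m\<^sup>2" "4 * b'\<^sup>2 = m\<^sup>2" "4 * c'\<^sup>2 = m\<^sup>2" "4 * d'\<^sup>2 = m\<^sup>2"
      using sq unfolding S_def power2_eq_square by linarith+
    moreover have "m dvd 2 * x" if "4 * x\<^sup>2 = m\<^sup>2" for x
    proof -
      have "(2 * x)\<^sup>2 = m\<^sup>2" using that by (simp add: power_mult_distrib)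
      then show ?thesis unfolding power2_eq_iff by auto
    qed
    ultimately have "m dvd 2 * a'" "m dvd 2 * b'" "m dvd 2 * c'" "m dvd 2 * d'"
      by blast+
    then have "m dvd 2 * a' * ta + 2 * b' * tb + 2 * c' * tc + 2 * d' * td"
      by simp
    then have "m * m dvd m * (2 * (a' * ta + b' * tb + c' * tc + d' * td))"
      by (intro mult_dvd_mono) (auto simp: algebra_simps)
    then have "m * m dvd m * p"
      unfolding S_expand r \<open>r = m\<close> by (simp add: power2_eq_square)
    then show False using not_dvd m0 by simp
  qed
  moreover have "r \<ge> 0"
    using r m0 unfolding S_def by (metis add_nonneg_nonneg zero_le_power2 zero_le_mult_iff not_less)
  moreover have "r \<noteq> 0"
  proof
    assume "r = 0"
    then have S0: "S = 0" using r by simp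
    then have "a' = 0 \<and> b' = 0 \<and> c' = 0 \<and> d' = 0"
      unfolding S_def by (smt (verit) power2_less_0 zero_eq_power2)
    then have "m * p = m * (m * (ta\<^sup>2 + tb\<^sup>2 + tc\<^sup>2 + td\<^sup>2))"
      using S_expand S0 by (simp add: power2_eq_square)
    then show False using not_dvd m0 by simp
  qed
  moreover have "four_squares (r * p)"
  proof -
    \<comment> \<open>Modulo m the primed and unprimed roots agree, so the three mixed components
      vanish and the first one becomes \<open>S\<close>, a multiple of m. The cofactors are written
      out so that m^2 can be cancelled.\<close>
    have "a*b' - b*a' + c*d' - d*c' = m * (ta*b' - tb*a' + tc*d' - td*c')"
      "a*c' - c*a' + d*b' - b*d' = m * (ta*c' - tc*a' + td*b' - tb*d')"
      "a*d' - d*a' + b*c' - c*b' = m * (ta*d' - td*a' + tb*c' - tc*b')"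
      "a*a' + b*b' + c*c' + d*d' = m * (r + ta*a' + tb*b' + tc*c' + td*d')"
      using r[symmetric] unfolding t S_def by (simp_all add: power2_eq_square algebra_simps)
    note z = this
    have "(m * p) * (m * r) = (a*a' + b*b' + c*c' + d*d')\<^sup>2 + (a*b' - b*a' + c*d' - d*c')\<^sup>2
      + (a*c' - c*a' + d*b' - b*d')\<^sup>2 + (a*d' - d*a' + b*c' - c*b')\<^sup>2"
      unfolding r[symmetric] S_def abcd by (simp add: power2_eq_square algebra_simps)
    then have "m\<^sup>2 * (r * p) = m\<^sup>2 * ((r + ta*a' + tb*b' + tc*c' + td*d')\<^sup>2
      + (ta*b' - tb*a' + tc*d' - td*c')\<^sup>2 + (ta*c' - tc*a' + td*b' - tb*d')\<^sup>2
      + (ta*d' - td*a' + tb*c' - tc*b')\<^sup>2)"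
      unfolding z by (simp add: power_mult_distrib power2_eq_square algebra_simps)
    then have "r * p = (r + ta*a' + tb*b' + tc*c' + td*d')\<^sup>2
      + (ta*b' - tb*a' + tc*d' - td*c')\<^sup>2 + (ta*c' - tc*a' + td*b' - tb*d')\<^sup>2
      + (ta*d' - td*a' + tb*c' - tc*b')\<^sup>2"
      using m0 by (metis mult_cancel_left power_not_zero less_irrefl)
    then show ?thesis unfolding four_squares_def by blast
  qed
  ultimately show ?thesis using that[of r] by simp
qed

text \<open>The descent starts at x^2 + y^2 + 1^2 + 0^2 = m p, where m < p because x and y are below
  p/2 in absolute value, and it ends at m = 1.\<close>

lemma four_squares_prime:
  fixes p :: int
  assumes p: "prime p"
  shows "four_squares p"
proof (cases "p = 2")
  case True
  have "(2::int) = 1\<^sup>2 + 1\<^sup>2 + 0\<^sup>2 + 0\<^sup>2" by simp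
  then show ?thesis unfolding True four_squares_def by blast
next
  case False
  have "odd p" using p False prime_odd_int prime_ge_2_int[OF p] by force
  obtain x y where xy: "p dvd x\<^sup>2 + y\<^sup>2 + 1" "2 * \<bar>x\<bar> < p" "2 * \<bar>y\<bar> < p"
    using prime_dvd_sum_two_squares_add_one[OF p \<open>odd p\<close>] .
  obtain m where m: "x\<^sup>2 + y\<^sup>2 + 1 = p * m" using xy(1) by blast
  have p2: "p > 2" using prime_ge_2_int[OF p] False by simp
  have "4 * x\<^sup>2 \<le> p\<^sup>2" "4 * y\<^sup>2 \<le> p\<^sup>2" using xy square_le_of_centered by auto
  moreover have "2 < p\<^sup>2" using p2 power_mono[of 2 p 2] by simp
  ultimately have "p * m < p * p" unfolding m[symmetric] power2_eq_square by linarith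
  then have mp: "m < p" using p2 by simp
  have m0: "m > 0" using m p2 by (smt (verit) zero_le_power2 zero_less_mult_pos)
  have "m * p = x\<^sup>2 + y\<^sup>2 + 1\<^sup>2 + 0\<^sup>2" using m by (simp add: mult.commute)
  then have "four_squares (m * p)" unfolding four_squares_def by blast
  moreover have "\<lbrakk>0 < m; m < p; four_squares (m * p)\<rbrakk> \<Longrightarrow> four_squares p" for m
  proof (induction "nat m" arbitrary: m rule: less_induct)
    case less
    show ?case
    proof (cases "m = 1")
      case True
      then show ?thesis using less by simp
    next
      case False
      then obtain r where "0 < r" "r < m" "four_squares (r * p)"
        using four_squares_descent[OF p _ less(3)] less by force
      then show ?thesis using less(1)[of r] less by simp
    qed
  qed
  ultimately show ?thesis using m0 mp by blast
qed

lemma four_squares_nat: "four_squares (int n)"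
proof (induction n rule: less_induct)
  case (less n)
  consider "n = 0" | "n = 1" | "n > 1" by linarith
  then show ?case
  proof cases
    case 1
    have "int n = 0\<^sup>2 + 0\<^sup>2 + 0\<^sup>2 + 0\<^sup>2" using 1 by simp
    then show ?thesis unfolding four_squares_def by blast
  next
    case 2
    have "int n = 1\<^sup>2 + 0\<^sup>2 + 0\<^sup>2 + 0\<^sup>2" using 2 by simp
    then show ?thesis unfolding four_squares_def by blast
  next
    case 3
    then obtain p where p: "prime p" "p dvd n" using prime_factor_nat[of n] by auto
    then obtain k where k: "n = p * k" by blast
    then have "k < n" using 3 prime_gt_1_nat[OF p(1)] by (cases "k = 0") auto
    then show ?thesis
      using four_squares_mult[OF four_squares_prime less, of "int p" k] p(1) k by simp
  qed
qed

section \<open>Four squares with exactly one odd term\<close>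

lemma odd_square_mod_4: "(x::int)\<^sup>2 mod 4 = (if odd x then 1 else 0)"
proof -
  have "x mod 4 = 0 \<or> x mod 4 = 1 \<or> x mod 4 = 2 \<or> x mod 4 = 3" by presburger
  moreover have "x\<^sup>2 mod 4 = (x mod 4)\<^sup>2 mod 4" by (simp add: power_mod)
  moreover have "odd x \<longleftrightarrow> odd (x mod 4)" by presburger
  ultimately show ?thesis by auto
qed

text \<open>Modulo 4 the sum counts the odd terms, so exactly one root is odd; it is moved to the
  front. The parity condition on a + b + c + d is what later puts the frame vectors into the
  lattice.\<close>

lemma four_squares_one_mod_four:
  obtains a b c d :: int where
    "(1 + 2*a)\<^sup>2 + (2*b)\<^sup>2 + (2*c)\<^sup>2 + (2*d)\<^sup>2 = 4 * int n + 1" "even (a + b + c + d)"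
proof -
  note witness = that
  obtain x y z u where s: "4 * int n + 1 = x\<^sup>2 + y\<^sup>2 + z\<^sup>2 + u\<^sup>2"
    using four_squares_nat[of "4 * n + 1"] unfolding four_squares_def by (auto simp: add.commute)
  have *: thesis if s: "4 * int n + 1 = x\<^sup>2 + y\<^sup>2 + z\<^sup>2 + u\<^sup>2" and o: "odd x" "even y" "even z" "even u"
    for x y z u :: int
  proof -
    obtain b c d where e: "y = 2*b" "z = 2*c" "u = 2*d" using o by (meson evenE)
    obtain a where a: "x = 1 + 2*a" using o(1) by (metis oddE add.commute)
    show thesis
    proof (cases "even (a + b + c + d)")
      case True
      then show thesis using witness[of a b c d] s e a by simp
    next
      case False
      \<comment> \<open>The root 1 + 2a is replaced by its negative, which sends a to -1 - a and so
        flips its parity.\<close>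
      have "(1 + 2 * (- 1 - a))\<^sup>2 + (2*b)\<^sup>2 + (2*c)\<^sup>2 + (2*d)\<^sup>2 = 4 * int n + 1"
        unfolding s a e by (simp add: power2_eq_square algebra_simps)
      moreover have "even ((- 1 - a) + b + c + d)" using False by presburger
      ultimately show thesis by (rule witness)
    qed
  qed
  have mod4: "(p mod 4 + q mod 4 + r mod 4 + s mod 4) mod 4 = (p + q + r + s) mod 4" for p q r s :: int
    by (intro mod_add_cong mod_mod_trivial)
  have "(x\<^sup>2 mod 4 + y\<^sup>2 mod 4 + z\<^sup>2 mod 4 + u\<^sup>2 mod 4) mod 4 = (x\<^sup>2 + y\<^sup>2 + z\<^sup>2 + u\<^sup>2) mod 4"
    using mod4[of "x\<^sup>2" "y\<^sup>2" "z\<^sup>2" "u\<^sup>2"] .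
  also have "\<dots> = 1" unfolding s[symmetric] by presburger
  finally consider "odd x" "even y" "even z" "even u" | "odd y" "even x" "even z" "even u"
    | "odd z" "even x" "even y" "even u" | "odd u" "even x" "even y" "even z"
    unfolding odd_square_mod_4 by (auto split: if_splits)
  then show thesis
  proof cases
    case 1 then show thesis using *[OF s] by simp
  next
    case 2 then show thesis using *[of y x z u] s by simp
  next
    case 3 then show thesis using *[of z x y u] s by simp
  next
    case 4 then show thesis using *[of u x y z] s by simp
  qed
qed

section \<open>Euclidean weights\<close>

definition dot :: "nat \<Rightarrow> (nat \<Rightarrow> int) \<Rightarrow> (nat \<Rightarrow> int) \<Rightarrow> int" where
  "dot n x y = (\<Sum>i<n. x i * y i)"

text \<open>The representative of least absolute value of a residue class modulo 2k.\<close>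

definition lift :: "nat \<Rightarrow> int \<Rightarrow> int" where
  "lift k a = (if a mod (2 * int k) \<le> int k then a mod (2 * int k) else a mod (2 * int k) - 2 * int k)"

lemma lift_cong: "2 * int k dvd lift k a - a"
proof -
  have "2 * int k dvd a mod (2 * int k) - a"
    by (metis dvd_minus_iff dvd_minus_mod minus_diff_eq)
  moreover have "2 * int k dvd (a mod (2 * int k) - a) - 2 * int k" using calculation by simp
  ultimately show ?thesis unfolding lift_def by (auto simp: algebra_simps)
qed

lemma abs_lift_le:
  assumes "k \<ge> 1"
  shows "\<bar>lift k a\<bar> \<le> int k"
proof -
  have "0 \<le> a mod (2 * int k)" "a mod (2 * int k) < 2 * int k" using assms by simp_all
  then show ?thesis unfolding lift_def by auto
qed

lemma abs_lift_minimal: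
  assumes "k \<ge> 1" "2 * int k dvd z - a"
  shows "\<bar>lift k a\<bar> \<le> \<bar>z\<bar>"
proof -
  have "2 * int k dvd lift k a - z"
    using dvd_diff[OF lift_cong[of k a] assms(2)] by simp
  then obtain t where t: "lift k a = z + 2 * int k * t"
    unfolding dvd_def by (metis add.commute diff_add_cancel)
  show ?thesis
  proof (cases "t = 0")
    case False
    then have "2 * int k * 1 \<le> 2 * int k * \<bar>t\<bar>" by (intro mult_left_mono) auto
    also have "\<dots> = \<bar>2 * int k * t\<bar>" by (simp add: abs_mult)
    finally show ?thesis using abs_lift_le[OF assms(1), of a] t by linarith
  qed (use t in simp)
qed

lemma lift_eq_pm_iff:
  assumes "k \<ge> 1" "1 \<le> \<alpha>" "\<alpha> \<le> k"
  shows "(a mod int (2*k) = int \<alpha> mod int (2*k) \<or> a mod int (2*k) = (- int \<alpha>) mod int (2*k))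
    \<longleftrightarrow> \<bar>lift k a\<bar> = int \<alpha>"
proof -
  define r where "r = a mod (2 * int k)"
  have "int \<alpha> mod (2 * int k) = int \<alpha>" using assms by simp
  moreover have "(- int \<alpha>) mod (2 * int k) = 2 * int k - int \<alpha>"
    using assms by (simp add: zmod_zminus1_eq_if)
  moreover have "0 \<le> r" "r < 2 * int k" using assms unfolding r_def by simp_all
  ultimately show ?thesis using assms unfolding lift_def of_nat_mult of_nat_numeral r_def[symmetric] by auto
qed

text \<open>After exchanging the sums, a position contributes only for the \<alpha> equal to the
  absolute value of its centred representative. At \<alpha> = k the two congruences coincide, but
  \<open>n_alpha\<close> counts positions, so nothing is counted twice.\<close>

lemma euclid_wt_lift:
  assumes "k \<ge> 1"
  shows "int (euclid_wt (2*k) n x) = (\<Sum>i<n. (lift k (x i))\<^sup>2)"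
proof -
  have n_alpha: "int (n_alpha (2*k) n \<alpha> x * \<alpha>\<^sup>2) = (\<Sum>i<n. if \<bar>lift k (x i)\<bar> = int \<alpha> then (int \<alpha>)\<^sup>2 else 0)"
    if "\<alpha> \<in> {1..k}" for \<alpha>
  proof -
    have "{i. i < n \<and> (x i mod int (2*k) = int \<alpha> mod int (2*k) \<or> x i mod int (2*k) = (- int \<alpha>) mod int (2*k))}
      = {i \<in> {..<n}. \<bar>lift k (x i)\<bar> = int \<alpha>}"
      using lift_eq_pm_iff[OF assms] that by auto
    then show ?thesis
      unfolding n_alpha_def by (simp add: sum.If_cases Int_def)
  qed
  have "int (euclid_wt (2*k) n x) = (\<Sum>\<alpha>=1..k. \<Sum>i<n. if \<bar>lift k (x i)\<bar> = int \<alpha> then (int \<alpha>)\<^sup>2 else 0)"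
    unfolding euclid_wt_def of_nat_sum using n_alpha by simp
  also have "\<dots> = (\<Sum>i<n. \<Sum>\<alpha>=1..k. if \<bar>lift k (x i)\<bar> = int \<alpha> then (int \<alpha>)\<^sup>2 else 0)"
    by (rule sum.swap)
  also have "\<dots> = (\<Sum>i<n. (lift k (x i))\<^sup>2)"
  proof (rule sum.cong[OF refl])
    fix i
    let ?a = "nat \<bar>lift k (x i)\<bar>"
    have "(\<Sum>\<alpha>=1..k. if \<bar>lift k (x i)\<bar> = int \<alpha> then (int \<alpha>)\<^sup>2 else 0)
      = (\<Sum>\<alpha>=1..k. if \<alpha> = ?a then (int ?a)\<^sup>2 else 0)"
      by (rule sum.cong) auto
    also have "\<dots> = (lift k (x i))\<^sup>2"
      using abs_lift_le[OF assms, of "x i"] by (auto simp: sum.delta)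
    finally show "(\<Sum>\<alpha>=1..k. if \<bar>lift k (x i)\<bar> = int \<alpha> then (int \<alpha>)\<^sup>2 else 0) = (lift k (x i))\<^sup>2" .
  qed
  finally show ?thesis .
qed

text \<open>The centred lift is the shortest vector of its class modulo 2k, so any representative
  bounds the weight from above.\<close>

lemma euclid_wt_le_norm:
  assumes "k \<ge> 1" "\<And>i. i < n \<Longrightarrow> 2 * int k dvd z i - x i"
  shows "int (euclid_wt (2*k) n x) \<le> dot n z z"
  unfolding euclid_wt_lift[OF assms(1)] dot_def
proof (rule sum_mono)
  fix i assume "i \<in> {..<n}"
  then have "\<bar>lift k (x i)\<bar>\<^sup>2 \<le> \<bar>z i\<bar>\<^sup>2"
    using abs_lift_minimal[OF assms(1)] assms(2) by (intro power_mono) auto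
  then show "(lift k (x i))\<^sup>2 \<le> z i * z i" by (simp add: power2_eq_square)
qed

lemma finite_zvecs: "finite (zvecs m n)"
proof -
  have "zvecs m n \<subseteq> {f. \<forall>i. (i \<in> {..<n} \<longrightarrow> f i \<in> {0..<int m}) \<and> (i \<notin> {..<n} \<longrightarrow> f i = 0)}"
    unfolding zvecs_def by auto
  moreover have "finite \<dots>" by (rule finite_set_of_finite_funs) auto
  ultimately show ?thesis by (rule finite_subset)
qed

text \<open>With \<open>n div 24 = 1\<close> the extremal value is 8k. Finiteness of the code is
  what gives \<open>Min\<close> its meaning here.\<close>

lemma extremal_type_II_I:
  assumes "k \<ge> 1" "n div 24 = 1" "self_dual (2*k) n C"
    and "\<And>x. x \<in> C \<Longrightarrow> 4 * k dvd euclid_wt (2*k) n x"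
    and "\<And>x. \<lbrakk>x \<in> C; x \<noteq> (\<lambda>_. 0)\<rbrakk> \<Longrightarrow> euclid_wt (2*k) n x \<ge> 8 * k"
    and "\<exists>x\<in>C. x \<noteq> (\<lambda>_. 0) \<and> euclid_wt (2*k) n x \<le> 8 * k"
  shows "extremal_type_II k n C"
proof -
  obtain x where x: "x \<in> C" "x \<noteq> (\<lambda>_. 0)" "euclid_wt (2*k) n x \<le> 8 * k" using assms(6) by blast
  have "C \<subseteq> zvecs (2*k) n" using assms(3) unfolding self_dual_def zcode_def by blast
  then have "finite C" using finite_zvecs finite_subset by blast
  then have "finite {euclid_wt (2*k) n x | x. x \<in> C \<and> x \<noteq> (\<lambda>_. 0)}" by simp
  moreover have "8 * k \<in> {euclid_wt (2*k) n x | x. x \<in> C \<and> x \<noteq> (\<lambda>_. 0)}"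
    using x assms(5)[of x] by force
  ultimately have "min_euclid (2*k) n C = 8 * k"
    unfolding min_euclid_def using assms(5) by (intro Min_eqI) auto
  then show ?thesis using assms unfolding extremal_type_II_def type_II_def by simp
qed

section \<open>The binary code and its lattice\<close>

lemma sum_lessThan_double: "(\<Sum>i<2 * h. f i) = (\<Sum>i<h. f i) + (\<Sum>i<h. f (h + i))"
  for f :: "nat \<Rightarrow> int"
proof -
  have "(\<Sum>i<h + m. f i) = (\<Sum>i<h. f i) + (\<Sum>i<m. f (h + i))" for m
    by (induction m) auto
  from this[of h] show ?thesis by (simp add: mult_2)
qed

lemma less_double_cases:
  fixes i h :: nat
  assumes "i < 2 * h"
  obtains "i < h" | j where "j < h" "i = h + j"
  using assms that(1) that(2)[of "i - h"] by fastforce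

lemma dot_commute: "dot n x y = dot n y x"
  unfolding dot_def by (simp add: mult.commute)

lemma dot_linear:
  "dot n x (\<lambda>i. a * y i + b * z i) = a * dot n x y + b * dot n x z"
  "dot n (\<lambda>i. a * y i + b * z i) x = a * dot n y x + b * dot n z x"
  unfolding dot_def by (simp_all add: algebra_simps sum.distrib sum_distrib_left)

lemma dot_cong: "\<lbrakk>\<And>i. i < n \<Longrightarrow> x i = x' i; \<And>i. i < n \<Longrightarrow> y i = y' i\<rbrakk> \<Longrightarrow> dot n x y = dot n x' y'"
  unfolding dot_def by (intro sum.cong) auto

lemma dot_sum: "dot n x (\<lambda>i. \<Sum>j\<in>J. c j * f j i) = (\<Sum>j\<in>J. c j * dot n x (f j))"
  unfolding dot_def sum_distrib_left sum_distrib_right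
  by (subst sum.swap) (simp add: algebra_simps)

lemma dot_self_ge_card:
  assumes "finite S" "S \<subseteq> {..<n}" "\<And>i. i \<in> S \<Longrightarrow> x i \<noteq> 0"
  shows "int (card S) \<le> dot n x x"
proof -
  have "int (card S) = (\<Sum>i\<in>S. 1)" by simp
  also have "\<dots> \<le> (\<Sum>i\<in>S. x i * x i)"
  proof (rule sum_mono)
    fix i assume "i \<in> S"
    then have "x i * x i > 0" using assms(3) by (simp add: zero_less_mult_iff linorder_neq_iff disj_commute)
    then show "1 \<le> x i * x i" by linarith
  qed
  also have "\<dots> \<le> dot n x x"
    unfolding dot_def using assms by (intro sum_mono2) auto
  finally show ?thesis .
qed

lemma even_dot_cong:
  assumes "\<And>i. i < n \<Longrightarrow> even (x i - y i)"
  shows "even (dot n x z - dot n y z)"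
proof -
  have "dot n x z - dot n y z = (\<Sum>i<n. (x i - y i) * z i)"
    unfolding dot_def by (simp add: algebra_simps sum_subtractf)
  also have "even \<dots>" using assms by (intro dvd_sum) auto
  finally show ?thesis .
qed

lemma four_dvd_dot_cong:
  assumes "\<And>i. i < n \<Longrightarrow> even (x i - y i)"
  shows "4 dvd dot n x x - dot n y y"
proof -
  have "4 dvd x i * x i - y i * y i" if i: "i < n" for i
  proof -
    have "even (x i + y i)" using assms[OF i] by presburger
    then have "2 * 2 dvd (x i - y i) * (x i + y i)" using assms[OF i] by (intro mult_dvd_mono)
    then show ?thesis by (simp add: algebra_simps)
  qed
  then have "4 dvd (\<Sum>i<n. x i * x i - y i * y i)" by (intro dvd_sum) auto
  then show ?thesis unfolding dot_def by (simp add: sum_subtractf)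
qed

lemma sum_orthogonal:
  fixes T :: "nat \<Rightarrow> nat \<Rightarrow> int"
  assumes "\<And>i j. \<lbrakk>i < h; j < h\<rbrakk> \<Longrightarrow> (\<Sum>l<h. T i l * T j l) = (if i = j then c else 0)" "i < h"
  shows "(\<Sum>l<h. T i l * (\<Sum>j<h. T j l * x j)) = c * x i"
proof -
  have "(\<Sum>l<h. T i l * (\<Sum>j<h. T j l * x j)) = (\<Sum>j<h. x j * (\<Sum>l<h. T i l * T j l))"
    unfolding sum_distrib_left by (subst sum.swap) (simp add: algebra_simps)
  also have "\<dots> = (\<Sum>j<h. if j = i then c * x i else 0)"
    using assms by (intro sum.cong) auto
  also have "\<dots> = c * x i" using assms(2) by simp
  finally show ?thesis .
qed

text \<open>Parseval's identity for a matrix with T T^t = c I. It serves both the binary code (c =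
  7) and the frame coordinates (c = 4k).\<close>

lemma sum_bilinear:
  fixes T :: "nat \<Rightarrow> nat \<Rightarrow> int"
  assumes "\<And>i j. \<lbrakk>i < h; j < h\<rbrakk> \<Longrightarrow> (\<Sum>l<h. T i l * T j l) = (if i = j then c else 0)"
  shows "(\<Sum>l<h. (\<Sum>i<h. T i l * x i) * (\<Sum>j<h. T j l * y j)) = c * (\<Sum>i<h. x i * y i)"
proof -
  have "(\<Sum>l<h. (\<Sum>i<h. T i l * x i) * (\<Sum>j<h. T j l * y j))
    = (\<Sum>i<h. x i * (\<Sum>l<h. T i l * (\<Sum>j<h. T j l * y j)))"
    unfolding sum_distrib_right sum_distrib_left[of "x _"]
    by (subst sum.swap) (simp add: algebra_simps)
  also have "\<dots> = (\<Sum>i<h. x i * (c * y i))"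
    using sum_orthogonal[OF assms] by (intro sum.cong) auto
  finally show ?thesis by (simp add: sum_distrib_left algebra_simps)
qed

lemma even_diff_cancel: "even b" if "even (a - b)" "even a" for a b :: int
  using that by simp

lemma odd_iff_odd: "odd d \<longleftrightarrow> odd a" if "even s" "s = b - a" "even (d + b)" for a b d s :: int
  using that by auto

text \<open>\<open>row_pair\<close> excludes codewords of weight 4 with two ones in each half.
  \<open>w_row\<close> and \<open>w_col\<close> say that 4 divides the inner products of w with the
  rows of [I | T] and [-T^t | I]. The bound on h makes vectors with all 2h coordinates odd long
  enough: their norm is at least 2h/8.\<close>

locale weighing_code =
  fixes h :: nat and T :: "nat \<Rightarrow> nat \<Rightarrow> int" and w :: "nat \<Rightarrow> int"
  assumes h_ge: "16 \<le> h"
    and row_dot: "\<lbrakk>i < h; j < h\<rbrakk> \<Longrightarrow> (\<Sum>l<h. T i l * T j l) = (if i = j then 7 else 0)"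
    and col_dot: "\<lbrakk>i < h; j < h\<rbrakk> \<Longrightarrow> (\<Sum>l<h. T l i * T l j) = (if i = j then 7 else 0)"
    and abs_entry: "\<lbrakk>i < h; j < h\<rbrakk> \<Longrightarrow> \<bar>T i j\<bar> \<le> 1"
    and row_pair: "\<lbrakk>i < h; j < h; i \<noteq> j\<rbrakk> \<Longrightarrow> 3 \<le> card {l. l < h \<and> odd (T i l + T j l)}"
    and w_odd: "i < 2 * h \<Longrightarrow> odd (w i)"
    and w_norm: "16 dvd dot (2 * h) w w"
    and w_row: "i < h \<Longrightarrow> 4 dvd w i + (\<Sum>l<h. T i l * w (h + l))"
    and w_col: "i < h \<Longrightarrow> 4 dvd w (h + i) - (\<Sum>l<h. T l i * w l)"
begin

abbreviation n where "n \<equiv> 2 * h"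

text \<open>The preimage in the integer vectors of the binary code of [I | T], so that codewords and
  lattice vectors can be handled alike.\<close>

definition code :: "(nat \<Rightarrow> int) \<Rightarrow> bool" where
  "code y \<longleftrightarrow> (\<forall>j<h. even (y (h + j) - (\<Sum>i<h. T i j * y i)))"

definition gen :: "nat \<Rightarrow> nat \<Rightarrow> int" where
  "gen i l = (if l < h then (if l = i then 1 else 0) else T i (l - h))"

text \<open>In the usual scaling the norm of a vector x of the lattice is x\<cdot>x / 8.\<close>

definition lattice :: "(nat \<Rightarrow> int) \<Rightarrow> bool" where
  "lattice x \<longleftrightarrow> (\<exists>t y. code y \<and> 4 dvd dot n w y \<and> (\<forall>i<n. x i = t * w i + 2 * y i))"

section \<open>Self-duality and minimum weight of the binary code\<close>

text \<open>Since 7 is odd, T^t is the inverse of T modulo 2, so the relation between the halves can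
  be solved for either one. The right-hand side says that y is orthogonal modulo 2 to the rows of
  [I | T], which gives self-duality.\<close>

lemma code_dual_iff: "code y \<longleftrightarrow> (\<forall>i<h. even (y i + (\<Sum>j<h. T i j * y (h + j))))"
proof
  assume c: "code y"
  show "\<forall>i<h. even (y i + (\<Sum>j<h. T i j * y (h + j)))"
  proof (intro allI impI)
    fix i assume i: "i < h"
    have "even (\<Sum>j<h. T i j * (y (h + j) - (\<Sum>l<h. T l j * y l)))"
      using c unfolding code_def by (intro dvd_sum) auto
    then have "even ((\<Sum>j<h. T i j * y (h + j)) - (\<Sum>j<h. T i j * (\<Sum>l<h. T l j * y l)))"
      by (simp only: right_diff_distrib sum_subtractf)
    then have "even ((\<Sum>j<h. T i j * y (h + j)) - 7 * y i)"
      using sum_orthogonal[OF row_dot i] by simp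
    then show "even (y i + (\<Sum>j<h. T i j * y (h + j)))" by presburger
  qed
next
  assume c: "\<forall>i<h. even (y i + (\<Sum>j<h. T i j * y (h + j)))"
  show "code y" unfolding code_def
  proof (intro allI impI)
    fix j assume j: "j < h"
    have "even (\<Sum>i<h. T i j * (y i + (\<Sum>l<h. T i l * y (h + l))))"
      using c by (intro dvd_sum) auto
    then have "even ((\<Sum>i<h. T i j * y i) + (\<Sum>i<h. T i j * (\<Sum>l<h. T i l * y (h + l))))"
      by (simp only: distrib_left sum.distrib)
    then have "even ((\<Sum>i<h. T i j * y i) + 7 * y (h + j))"
      using sum_orthogonal[of h "\<lambda>a b. T b a", OF col_dot j, of "\<lambda>l. y (h + l)"] by simp
    then show "even (y (h + j) - (\<Sum>i<h. T i j * y i))" by presburger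
  qed
qed

lemma code_linear:
  assumes "code x" "code y"
  shows "code (\<lambda>i. a * x i + b * y i)"
proof -
  have "a * x (h + j) + b * y (h + j) - (\<Sum>i<h. T i j * (a * x i + b * y i))
    = a * (x (h + j) - (\<Sum>i<h. T i j * x i)) + b * (y (h + j) - (\<Sum>i<h. T i j * y i))" for j
    by (simp add: algebra_simps sum.distrib sum_distrib_left)
  then show ?thesis using assms unfolding code_def by simp
qed

lemma code_cong:
  assumes "code x" "\<And>i. i < n \<Longrightarrow> even (x i - y i)"
  shows "code y"
  unfolding code_def
proof (intro allI impI)
  fix j assume j: "j < h"
  have "(x (h + j) - (\<Sum>i<h. T i j * x i)) - (y (h + j) - (\<Sum>i<h. T i j * y i))
    = (x (h + j) - y (h + j)) - (\<Sum>i<h. T i j * (x i - y i))"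
    by (simp add: algebra_simps sum_subtractf)
  also have "even \<dots>"
  proof (rule dvd_diff)
    show "even (x (h + j) - y (h + j))" using assms(2) j by simp
    show "even (\<Sum>i<h. T i j * (x i - y i))" using assms(2) by (intro dvd_sum dvd_mult) simp
  qed
  finally have "even ((x (h + j) - (\<Sum>i<h. T i j * x i)) - (y (h + j) - (\<Sum>i<h. T i j * y i)))" .
  moreover have "even (x (h + j) - (\<Sum>i<h. T i j * x i))" using assms(1) j unfolding code_def by blast
  ultimately show "even (y (h + j) - (\<Sum>i<h. T i j * y i))" by (rule even_diff_cancel)
qed

lemma code_even: "(\<And>i. i < n \<Longrightarrow> even (y i)) \<Longrightarrow> code y"
  by (rule code_cong[of "\<lambda>_. 0"]) (auto simp: code_def)

lemma code_gen: "i < h \<Longrightarrow> code (gen i)"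
  unfolding code_def gen_def by (simp add: if_distrib[of "(*) _"] cong: if_cong)

lemma dot_gen: "i < h \<Longrightarrow> dot n u (gen i) = u i + (\<Sum>j<h. T i j * u (h + j))"
  unfolding dot_def sum_lessThan_double gen_def
  by (simp add: if_distrib[of "(*) _"] mult.commute cong: if_cong)

text \<open>The congruent vector z is an integer combination of rows of [I | T]. These have Gram
  matrix 8 I, so inner products of such vectors are multiples of 8 on the nose.\<close>

lemma code_eqvec:
  assumes "code y"
  obtains z where "\<And>i. i < h \<Longrightarrow> z i = y i" "\<And>j. j < h \<Longrightarrow> z (h + j) = (\<Sum>i<h. T i j * y i)"
    "\<And>i. i < n \<Longrightarrow> even (y i - z i)"
proof -
  define z where "z = (\<lambda>l. if l < h then y l else (\<Sum>i<h. T i (l - h) * y i))"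
  have "even (y i - z i)" if "i < n" for i
    using that assms unfolding z_def code_def by (cases rule: less_double_cases) auto
  then show thesis using that[of z] unfolding z_def by simp
qed

lemma code_dot_even:
  assumes "code x" "code y"
  shows "even (dot n x y)"
proof -
  obtain x' where x': "\<And>i. i < h \<Longrightarrow> x' i = x i" "\<And>j. j < h \<Longrightarrow> x' (h + j) = (\<Sum>i<h. T i j * x i)"
    "\<And>i. i < n \<Longrightarrow> even (x i - x' i)" using code_eqvec[OF assms(1)] by blast
  obtain y' where y': "\<And>i. i < h \<Longrightarrow> y' i = y i" "\<And>j. j < h \<Longrightarrow> y' (h + j) = (\<Sum>i<h. T i j * y i)"
    "\<And>i. i < n \<Longrightarrow> even (y i - y' i)" using code_eqvec[OF assms(2)] by blast
  have "dot n x' y' = 8 * (\<Sum>i<h. x i * y i)"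
    unfolding dot_def sum_lessThan_double using x' y' sum_bilinear[OF row_dot, of x y] by simp
  moreover have "even (dot n x y - dot n x' y)" using x' by (intro even_dot_cong) auto
  moreover have "even (dot n y x' - dot n y' x')" using y' by (intro even_dot_cong) auto
  ultimately show ?thesis
    unfolding dot_commute[of n y x'] dot_commute[of n y' x'] by presburger
qed

lemma code_norm:
  assumes "code y"
  shows "4 dvd dot n y y"
proof -
  obtain z where z: "\<And>i. i < h \<Longrightarrow> z i = y i" "\<And>j. j < h \<Longrightarrow> z (h + j) = (\<Sum>i<h. T i j * y i)"
    "\<And>i. i < n \<Longrightarrow> even (y i - z i)" using code_eqvec[OF assms(1)] by blast
  have "dot n z z = 8 * (\<Sum>i<h. y i * y i)"
    unfolding dot_def sum_lessThan_double using z sum_bilinear[OF row_dot, of y y] by simp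
  moreover have "4 dvd dot n y y - dot n z z" using z by (intro four_dvd_dot_cong) auto
  ultimately show ?thesis by presburger
qed

lemma code_self_dual:
  assumes "\<And>c. code c \<Longrightarrow> even (dot n u c)"
  shows "code u"
  unfolding code_dual_iff using assms[OF code_gen] dot_gen by simp

text \<open>Modulo 2, w is the all-one word and w\<cdot>c agrees with c\<cdot>c, which is
  even.\<close>

lemma code_w: "code w"
proof (rule code_self_dual)
  fix c assume "code c"
  then have "even (dot n c c)" using code_dot_even by blast
  moreover have "dot n w c - dot n c c = (\<Sum>i<n. (w i - c i) * c i)"
    unfolding dot_def by (simp add: algebra_simps sum_subtractf)
  moreover have "even (\<Sum>i<n. (w i - c i) * c i)" using w_odd by (intro dvd_sum) auto
  ultimately show "even (dot n w c)" by presburger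
qed

lemma card_odd_row:
  assumes "i < h"
  shows "card {l. l < h \<and> odd (T i l)} = 7"
proof -
  have "(\<Sum>l<h. T i l * T i l) = (\<Sum>l<h. if odd (T i l) then 1 else 0)"
  proof (rule sum.cong[OF refl])
    fix l assume "l \<in> {..<h}"
    then have "T i l = 0 \<or> T i l = 1 \<or> T i l = - 1" using abs_entry[OF assms, of l] by auto
    then show "T i l * T i l = (if odd (T i l) then 1 else 0)" by auto
  qed
  also have "\<dots> = int (card {l. l < h \<and> odd (T i l)})"
    by (simp add: sum.If_cases Int_def)
  finally show ?thesis using row_dot[OF assms assms] by simp
qed

lemma card_odd_col:
  assumes "i < h"
  shows "card {l. l < h \<and> odd (T l i)} = 7"
proof -
  have "(\<Sum>l<h. T l i * T l i) = (\<Sum>l<h. if odd (T l i) then 1 else 0)"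
  proof (rule sum.cong[OF refl])
    fix l assume "l \<in> {..<h}"
    then have "T l i = 0 \<or> T l i = 1 \<or> T l i = - 1" using abs_entry[OF _ assms, of l] by auto
    then show "T l i * T l i = (if odd (T l i) then 1 else 0)" by auto
  qed
  also have "\<dots> = int (card {l. l < h \<and> odd (T l i)})"
    by (simp add: sum.If_cases Int_def)
  finally show ?thesis using col_dot[OF assms assms] by simp
qed

text \<open>
A word of weight 4 has weight at most 2 in the left half or at most 1 in the right half, so that one
of the dual pair of generator matrices [I | T] and [T^t | I] exhibits it as a sum of few rows.
\<close>

lemma code_min_weight:
  assumes c: "code y" and "i < n" "odd (y i)"
  shows "8 \<le> card {i. i < n \<and> odd (y i)}"
proof (rule ccontr)
  assume less: "\<not> 8 \<le> card {i. i < n \<and> odd (y i)}"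
  define A where "A = {i. i < h \<and> odd (y i)}"
  define B where "B = {j. j < h \<and> odd (y (h + j))}"
  have fin: "finite A" "finite B" unfolding A_def B_def by auto
  have split: "{i. i < n \<and> odd (y i)} = A \<union> (+) h ` B"
    unfolding A_def B_def by (auto elim: less_double_cases)
  have card: "card {i. i < n \<and> odd (y i)} = card A + card B"
    unfolding split using fin by (subst card_Un_disjoint) (auto simp: A_def card_image)
  \<comment> \<open>The 0-1 vector with the parities of y has its Hamming weight as norm, so
    doubly-evenness passes to the weight and leaves only weight 4 to exclude.\<close>
  have "4 dvd dot n y y - dot n (\<lambda>i. if odd (y i) then 1 else 0) (\<lambda>i. if odd (y i) then 1 else 0)"
    by (rule four_dvd_dot_cong) auto
  moreover have "dot n (\<lambda>i. if odd (y i) then 1 else 0) (\<lambda>i. if odd (y i) then 1 else 0)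
    = (\<Sum>i<n. if odd (y i) then 1 else 0)" unfolding dot_def by (intro sum.cong) auto
  moreover have "\<dots> = int (card {i. i < n \<and> odd (y i)})"
    by (simp add: sum.If_cases Int_def)
  ultimately have "4 dvd int (card A + card B)" using code_norm[OF c] card by presburger
  then have "4 dvd card A + card B" by presburger
  moreover have "card A + card B \<noteq> 0"
    using assms(2,3) fin unfolding card[symmetric] by auto
  ultimately have sum4: "card A + card B = 4" using less card by presburger
  have right: "odd (y (h + j)) \<longleftrightarrow> odd (\<Sum>i\<in>A. T i j)" if "j < h" for j
  proof (rule odd_iff_odd)
    show "even (\<Sum>i<h. T i j * (y i - (if odd (y i) then 1 else 0)))" by (intro dvd_sum) auto
    have "(\<Sum>i<h. if odd (y i) then T i j else 0) = (\<Sum>i\<in>A. T i j)"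
      unfolding A_def by (simp add: sum.If_cases Int_def)
    then show "(\<Sum>i<h. T i j * (y i - (if odd (y i) then 1 else 0)))
      = (\<Sum>i<h. T i j * y i) - (\<Sum>i\<in>A. T i j)"
      unfolding right_diff_distrib sum_subtractf by (simp add: if_distrib[of "(*) _"] cong: if_cong)
    show "even (y (h + j) + (\<Sum>i<h. T i j * y i))" using c that unfolding code_def by simp
  qed
  have left: "odd (y i) \<longleftrightarrow> odd (\<Sum>j\<in>B. T i j)" if "i < h" for i
  proof (rule odd_iff_odd)
    show "even (\<Sum>j<h. T i j * (y (h + j) - (if odd (y (h + j)) then 1 else 0)))"
      by (intro dvd_sum) auto
    have "(\<Sum>j<h. if odd (y (h + j)) then T i j else 0) = (\<Sum>j\<in>B. T i j)"
      unfolding B_def by (simp add: sum.If_cases Int_def)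
    then show "(\<Sum>j<h. T i j * (y (h + j) - (if odd (y (h + j)) then 1 else 0)))
      = (\<Sum>j<h. T i j * y (h + j)) - (\<Sum>j\<in>B. T i j)"
      unfolding right_diff_distrib sum_subtractf by (simp add: if_distrib[of "(*) _"] cong: if_cong)
    show "even (y i + (\<Sum>j<h. T i j * y (h + j)))" using c that unfolding code_dual_iff by blast
  qed
  \<comment> \<open>The ones split between the halves as 0+4, 1+3, 2+2, 3+1 or 4+0. A single row or
    column would contribute 7 instead of 3, and two rows at least 3 instead of 2.\<close>
  consider "card A = 0" | "card A = 1" | "card A = 2" | "card B = 0" | "card B = 1"
    using sum4 by linarith
  then show False
  proof cases
    case 1
    then have "B = {}" using right fin unfolding B_def by auto
    then show False using sum4 1 by simp
  next
    case 2
    then obtain a where a: "A = {a}" using card_1_singletonE by blast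
    then have "B = {j. j < h \<and> odd (T a j)}" unfolding B_def using right by auto
    then show False using card_odd_row[of a] a sum4 unfolding A_def by auto
  next
    case 3
    then obtain a b where ab: "A = {a, b}" "a \<noteq> b" unfolding card_2_iff by blast
    then have "B = {j. j < h \<and> odd (T a j + T b j)}" unfolding B_def using right by auto
    moreover have "a < h" "b < h" using ab unfolding A_def by auto
    ultimately show False using row_pair[of a b] ab(2) sum4 3 by simp
  next
    case 4
    then have "A = {}" using left fin unfolding A_def by auto
    then show False using sum4 4 by simp
  next
    case 5
    then obtain b where b: "B = {b}" using card_1_singletonE by blast
    then have "A = {i. i < h \<and> odd (T i b)}" unfolding A_def using left by auto
    then show False using card_odd_col[of b] b sum4 unfolding B_def by auto
  qed
qed

section \<open>The even lattice and its minimum\<close>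

lemma lattice_even:
  assumes "code y" "4 dvd dot n w y" "\<And>i. i < n \<Longrightarrow> x i = 2 * y i"
  shows "lattice x"
  unfolding lattice_def using assms by (intro exI[of _ 0] exI[of _ y]) auto

text \<open>As w is odd everywhere, one even coordinate makes t even. Then t w is absorbed into 2y,
  which is allowed because w is itself in the code and 4 divides w\<cdot>w.\<close>

lemma lattice_evenE:
  assumes "lattice x" "i < n" "even (x i)"
  obtains y where "code y" "4 dvd dot n w y" "\<And>i. i < n \<Longrightarrow> x i = 2 * y i"
proof -
  obtain t y where y: "code y" "4 dvd dot n w y" "\<And>i. i < n \<Longrightarrow> x i = t * w i + 2 * y i"
    using assms(1) unfolding lattice_def by blast
  have "even t" using y(3)[OF assms(2)] assms(3) w_odd[OF assms(2)] by auto
  then obtain s where s: "t = 2 * s" by blast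
  have "code (\<lambda>i. s * w i + 1 * y i)" using code_linear code_w y(1) by blast
  moreover have "4 dvd dot n w (\<lambda>i. s * w i + 1 * y i)"
    unfolding dot_linear using w_norm y(2) by (intro dvd_add dvd_mult) presburger+
  ultimately show thesis using that[of "\<lambda>i. s * w i + 1 * y i"] y(3) s by (simp add: algebra_simps)
qed

lemma lattice_w: "lattice w"
  unfolding lattice_def by (intro exI[of _ 1] exI[of _ "\<lambda>_. 0"]) (simp add: code_even dot_def)

lemma lattice_zero: "lattice (\<lambda>_. 0)"
  by (rule lattice_even[of "\<lambda>_. 0"]) (simp_all add: code_even dot_def)

lemma lattice_linear:
  assumes "lattice x" "lattice y"
  shows "lattice (\<lambda>i. a * x i + b * y i)"
proof -
  obtain t x' where x: "code x'" "4 dvd dot n w x'" "\<And>i. i < n \<Longrightarrow> x i = t * w i + 2 * x' i"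
    using assms(1) unfolding lattice_def by blast
  obtain u y' where y: "code y'" "4 dvd dot n w y'" "\<And>i. i < n \<Longrightarrow> y i = u * w i + 2 * y' i"
    using assms(2) unfolding lattice_def by blast
  have "code (\<lambda>i. a * x' i + b * y' i)" using code_linear x(1) y(1) by blast
  moreover have "4 dvd dot n w (\<lambda>i. a * x' i + b * y' i)" unfolding dot_linear using x(2) y(2) by auto
  moreover have "\<forall>i<n. a * x i + b * y i = (a * t + b * u) * w i + 2 * (a * x' i + b * y' i)"
    using x(3) y(3) by (simp add: algebra_simps)
  ultimately show ?thesis unfolding lattice_def by blast
qed

lemma lattice_sum:
  assumes "finite J" "\<And>j. j \<in> J \<Longrightarrow> lattice (f j)"
  shows "lattice (\<lambda>i. \<Sum>j\<in>J. c j * f j i)"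
  using assms
proof (induction J rule: finite_induct)
  case empty
  show ?case using lattice_zero by simp
next
  case (insert j J)
  have "lattice (\<lambda>i. c j * f j i + 1 * (\<Sum>j\<in>J. c j * f j i))"
    using insert by (intro lattice_linear) auto
  then show ?case using insert by simp
qed

lemma lattice_dot:
  assumes "lattice x" "lattice y"
  shows "8 dvd dot n x y"
proof -
  obtain t x' where x: "code x'" "4 dvd dot n w x'" "\<And>i. i < n \<Longrightarrow> x i = t * w i + 2 * x' i"
    using assms(1) unfolding lattice_def by blast
  obtain u y' where y: "code y'" "4 dvd dot n w y'" "\<And>i. i < n \<Longrightarrow> y i = u * w i + 2 * y' i"
    using assms(2) unfolding lattice_def by blast
  have "dot n x y = dot n (\<lambda>i. t * w i + 2 * x' i) (\<lambda>i. u * w i + 2 * y' i)"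
    using x(3) y(3) by (rule dot_cong)
  also have "\<dots> = t * u * dot n w w + 2 * t * dot n w y' + 2 * u * dot n w x' + 4 * dot n x' y'"
    unfolding dot_linear dot_commute[of n x' w] by (simp add: algebra_simps)
  finally have e: "dot n x y = \<dots>" .
  obtain p where "dot n w w = 16 * p" using w_norm by blast
  moreover obtain q where "dot n w y' = 4 * q" using y(2) by blast
  moreover obtain r where "dot n w x' = 4 * r" using x(2) by blast
  moreover obtain s where "dot n x' y' = 2 * s" using code_dot_even[OF x(1) y(1)] by blast
  ultimately have "dot n x y = 8 * (2 * t * u * p + t * q + u * r + s)"
    unfolding e by (simp add: algebra_simps)
  then show ?thesis by simp
qed

lemma lattice_norm:
  assumes "lattice x"
  shows "16 dvd dot n x x"
proof -
  obtain t x' where x: "code x'" "4 dvd dot n w x'" "\<And>i. i < n \<Longrightarrow> x i = t * w i + 2 * x' i"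
    using assms(1) unfolding lattice_def by blast
  have "dot n x x = dot n (\<lambda>i. t * w i + 2 * x' i) (\<lambda>i. t * w i + 2 * x' i)"
    using x(3) x(3) by (rule dot_cong)
  also have "\<dots> = t * t * dot n w w + 4 * t * dot n w x' + 4 * dot n x' x'"
    unfolding dot_linear dot_commute[of n x' w] by (simp add: algebra_simps)
  finally have e: "dot n x x = \<dots>" .
  obtain p where "dot n w w = 16 * p" using w_norm by blast
  moreover obtain q where "dot n w x' = 4 * q" using x(2) by blast
  moreover obtain s where "dot n x' x' = 4 * s" using code_norm[OF x(1)] by blast
  ultimately have "dot n x x = 16 * (t * t * p + t * q + s)"
    unfolding e by (simp add: algebra_simps)
  then show ?thesis by simp
qed

text \<open>Three kinds of vectors: for odd t all 2h coordinates are odd; for x = 2y with y odd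
  somewhere the minimum weight 8 gives 4 * 8; for x = 4z the condition on w makes z\<cdot>z even,
  giving 16 * 2.\<close>

lemma lattice_min_norm:
  assumes x: "lattice x" and i: "i < n" "x i \<noteq> 0"
  shows "32 \<le> dot n x x"
proof (cases "even (x i)")
  case False
  obtain t x' where x': "\<And>i. i < n \<Longrightarrow> x i = t * w i + 2 * x' i"
    using x unfolding lattice_def by blast
  have "odd t" using False x'[OF i(1)] by auto
  then have "odd (x j)" if "j < n" for j using x'[OF that] w_odd[OF that] by simp
  then have "x j \<noteq> 0" if "j < n" for j using that by fastforce
  then have "int (card {..<n}) \<le> dot n x x" by (intro dot_self_ge_card) auto
  then show ?thesis using h_ge by simp
next
  case True
  obtain y where y: "code y" "4 dvd dot n w y" "\<And>i. i < n \<Longrightarrow> x i = 2 * y i"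
    using lattice_evenE[OF x i(1) True] by blast
  have xy: "dot n x x = 4 * dot n y y"
    unfolding dot_def sum_distrib_left using y(3) by (intro sum.cong) auto
  show ?thesis
  proof (cases "\<exists>j<n. odd (y j)")
    case True
    then have "8 \<le> card {i. i < n \<and> odd (y i)}" using code_min_weight[OF y(1)] by blast
    moreover have "int (card {i. i < n \<and> odd (y i)}) \<le> dot n y y"
      by (rule dot_self_ge_card) (auto intro: ccontr)
    ultimately show ?thesis unfolding xy by linarith
  next
    case False
    define z where "z = (\<lambda>j. y j div 2)"
    have z: "y j = 2 * z j" if "j < n" for j using False that unfolding z_def by simp
    have "dot n w y = 2 * dot n w z" "dot n y y = 4 * dot n z z"
      unfolding dot_def sum_distrib_left using z by (auto intro!: sum.cong)
    \<comment> \<open>Each w_i is odd and z_i^2 has the parity of z_i. As 4 divides w\<cdot>y = 2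
      (w\<cdot>z), this makes z\<cdot>z even.\<close>
    moreover have "even (dot n w z - dot n z z)"
    proof -
      have "dot n w z - dot n z z = (\<Sum>i<n. (w i - z i) * z i)"
        unfolding dot_def by (simp add: algebra_simps sum_subtractf)
      also have "even \<dots>" using w_odd by (intro dvd_sum) auto
      finally show ?thesis .
    qed
    moreover have "int (card {i}) \<le> dot n z z"
      using i y(3) z by (intro dot_self_ge_card) auto
    ultimately have "2 \<le> dot n z z" using y(2) by simp presburger
    then show ?thesis unfolding xy \<open>dot n y y = 4 * dot n z z\<close> by simp
  qed
qed

section \<open>Unimodularity\<close>

text \<open>Minimal vectors 4 e_i + 4 e_j of the lattice. For i = j this is 8 e_i, pairing with
  which isolates a single coordinate.\<close>

definition pair_vec :: "nat \<Rightarrow> nat \<Rightarrow> nat \<Rightarrow> int" where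
  "pair_vec i j = (\<lambda>l. (if l = i then 4 else 0) + (if l = j then 4 else 0))"

lemma dot_pair_vec:
  assumes "i < n" "j < n"
  shows "dot n x (pair_vec i j) = 4 * (x i + x j)"
  unfolding dot_def pair_vec_def using assms
  by (simp add: algebra_simps sum.distrib if_distrib[of "(*) _"] cong: if_cong)

lemma lattice_pair_vec:
  assumes "i < n" "j < n"
  shows "lattice (pair_vec i j)"
proof (rule lattice_even)
  let ?y = "\<lambda>l. (if l = i then 2 else 0) + (if l = j then 2 else 0) :: int"
  show "code ?y" by (rule code_even) auto
  have "dot n w ?y = 2 * (w i + w j)"
    unfolding dot_def using assms
    by (simp add: algebra_simps sum.distrib if_distrib[of "(*) _"] cong: if_cong)
  moreover have "even (w i + w j)" using w_odd assms by auto
  ultimately show "4 dvd dot n w ?y" by presburger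
qed (auto simp: pair_vec_def)

text \<open>Pairing with the vectors 4 e_0 + 4 e_i shows that all coordinates of v have the same
  parity, and adding w reduces the odd case to the even one. For v = 2u, pairing with doubled
  codewords puts u into the self-dual code, and pairing with w gives the condition on
  w\<cdot>u.\<close>

lemma lattice_unimodular:
  assumes "\<And>x. lattice x \<Longrightarrow> 8 dvd dot n v x"
  shows "lattice v"
proof -
  have n0: "0 < n" using h_ge by simp
  have even_case: "lattice v" if v: "\<And>x. lattice x \<Longrightarrow> 8 dvd dot n v x" and e: "even (v 0)" for v
  proof -
    have "even (v i)" if "i < n" for i
    proof -
      have "8 dvd 4 * (v 0 + v i)"
        using v[OF lattice_pair_vec[OF n0 that]] dot_pair_vec[OF n0 that] by simp
      then show ?thesis using e by presburger
    qed
    then have u: "v i = 2 * (v i div 2)" if "i < n" for i using that by simp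
    define u where "u = (\<lambda>i. v i div 2)"
    have dot_v: "dot n v x = 2 * dot n u x" for x
      unfolding dot_def sum_distrib_left u_def using u by (intro sum.cong) auto
    have "code u"
    proof (rule code_self_dual)
      fix c assume c: "code c"
      \<comment> \<open>This representative of c satisfies w\<cdot>c' = c'\<cdot>c', which 4
        divides, so 2c' lies in the lattice; 2c itself need not.\<close>
      define c' where "c' = (\<lambda>i. if odd (c i) then w i else 0)"
      have c'_even: "even (c i - c' i)" if "i < n" for i using w_odd[OF that] unfolding c'_def by auto
      then have "code c'" using code_cong[OF c] by blast
      moreover have "dot n w c' = dot n c' c'"
        unfolding dot_def c'_def by (intro sum.cong) auto
      ultimately have "lattice (\<lambda>i. 2 * c' i)" using code_norm by (intro lattice_even[of c']) auto
      then have "8 dvd 2 * dot n u (\<lambda>i. 2 * c' i)" using v dot_v by metis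
      moreover have "dot n u (\<lambda>i. 2 * c' i) = 2 * dot n u c'"
        unfolding dot_def by (simp add: sum_distrib_left algebra_simps)
      ultimately have "even (dot n u c')" by presburger
      moreover have "even (dot n c u - dot n c' u)" using c'_even by (rule even_dot_cong)
      ultimately show "even (dot n u c)"
        unfolding dot_commute[of n c u] dot_commute[of n c' u] by presburger
    qed
    moreover have "8 dvd 2 * dot n u w" using v[OF lattice_w] dot_v by metis
    then have "4 dvd dot n w u" unfolding dot_commute[of n w u] by presburger
    ultimately show "lattice v" using u by (intro lattice_even[of u]) (auto simp: u_def)
  qed
  show ?thesis
  proof (cases "even (v 0)")
    case True
    then show ?thesis using even_case assms by blast
  next
    case False
    have "lattice (\<lambda>i. 1 * v i + 1 * w i)"
    proof (rule even_case)
      show "8 dvd dot n (\<lambda>i. 1 * v i + 1 * w i) x" if "lattice x" for x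
        unfolding dot_linear using assms[OF that] lattice_dot[OF lattice_w that] by simp
      show "even (1 * v 0 + 1 * w 0)" using False w_odd[OF n0] by simp
    qed
    then have "lattice (\<lambda>i. 1 * (1 * v i + 1 * w i) + (- 1) * w i)"
      using lattice_w by (rule lattice_linear)
    then show ?thesis by simp
  qed
qed

end

section \<open>Codes from frames\<close>

lemma dvd_mult_diff:
  fixes m a b c d :: int
  assumes "m dvd a - b" "m dvd c - d"
  shows "m dvd a * c - b * d"
proof -
  have "a * c - b * d = (a - b) * c + b * (c - d)" by (simp add: algebra_simps)
  then show ?thesis using assms by simp
qed

lemma dvd_dot_diff:
  assumes "\<And>i. i < n \<Longrightarrow> m dvd x i - x' i" "\<And>i. i < n \<Longrightarrow> m dvd y i - y' i"
  shows "m dvd dot n x y - dot n x' y'"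
  unfolding dot_def sum_subtractf[symmetric] using assms by (intro dvd_sum dvd_mult_diff) auto

lemma zvecs_eqI:
  assumes "x \<in> zvecs m n" "y \<in> zvecs m n" "\<And>i. i < n \<Longrightarrow> int m dvd x i - y i"
  shows "x = y"
proof
  fix i
  show "x i = y i"
  proof (cases "i < n")
    case True
    then have "x i mod int m = x i" "y i mod int m = y i" using assms unfolding zvecs_def by auto
    then show ?thesis using assms(3)[OF True] by (metis mod_eq_dvd_iff)
  next
    case False
    then show ?thesis using assms unfolding zvecs_def by auto
  qed
qed

definition residue_vec :: "nat \<Rightarrow> nat \<Rightarrow> (nat \<Rightarrow> int) \<Rightarrow> nat \<Rightarrow> int" where
  "residue_vec m n x = (\<lambda>i. if i < n then x i mod int m else 0)"

lemma residue_vec_zvecs: "0 < m \<Longrightarrow> residue_vec m n x \<in> zvecs m n"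
  unfolding residue_vec_def zvecs_def by auto

lemma residue_vec_cong: "i < n \<Longrightarrow> int m dvd x i - residue_vec m n x i"
  unfolding residue_vec_def by (simp add: minus_mod_eq_mult_div)

lemma zadd_residue: "zadd m n x y = residue_vec m n (\<lambda>i. x i + y i)"
  unfolding zadd_def residue_vec_def by auto

lemma zsmult_residue: "zsmult m n a x = residue_vec m n (\<lambda>i. a * x i)"
  unfolding zsmult_def residue_vec_def by auto

lemma residue_vec_eq_0: "residue_vec m n x = (\<lambda>_. 0) \<longleftrightarrow> (\<forall>i<n. int m dvd x i)"
  unfolding residue_vec_def by (auto simp: fun_eq_iff dvd_eq_mod_eq_0)

context weighing_code
begin

lemma gen_norm: "i < h \<Longrightarrow> dot n (gen i) (gen i) = 8"
proof -
  assume i: "i < h"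
  have "(\<Sum>j<h. T i j * gen i (h + j)) = 7" using row_dot[OF i i] unfolding gen_def by simp
  then show ?thesis using dot_gen[OF i, of "gen i"] i unfolding gen_def by simp
qed

text \<open>For k = 1 the Euclidean weight of a 0-1 word is its Hamming weight, and a row of [I | T]
  attains 8.\<close>

lemma extremal_binary:
  assumes "n div 24 = 1"
  shows "\<exists>C. extremal_type_II 1 n C"
proof
  let ?C = "{c \<in> zvecs 2 n. code c}"
  have residue: "residue_vec 2 n x \<in> ?C" if "code x" for x
  proof -
    have "code (residue_vec 2 n x)"
      using residue_vec_cong[of _ n 2 x] by (intro code_cong[OF that]) simp
    then show ?thesis using residue_vec_zvecs[of 2 n x] by simp
  qed
  have dual: "?C = zdual 2 n ?C"
  proof
    show "?C \<subseteq> zdual 2 n ?C"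
      using code_dot_even unfolding zdual_def dot_def by (auto simp: even_iff_mod_2_eq_zero)
    show "zdual 2 n ?C \<subseteq> ?C"
    proof
      fix u assume u: "u \<in> zdual 2 n ?C"
      have "code u"
      proof (rule code_self_dual)
        fix c assume c: "code c"
        have "even (dot n u (residue_vec 2 n c))"
          using residue[OF c] u unfolding zdual_def dot_def by (auto simp: even_iff_mod_2_eq_zero)
        moreover have "2 dvd dot n u c - dot n u (residue_vec 2 n c)"
          using residue_vec_cong[of _ n 2 c] by (intro dvd_dot_diff) auto
        ultimately show "even (dot n u c)" by presburger
      qed
      then show "u \<in> ?C" using u unfolding zdual_def by simp
    qed
  qed
  have "zcode 2 n ?C" unfolding zcode_def
  proof (intro conjI ballI allI)
    show "(\<lambda>_. 0) \<in> ?C" by (simp add: zvecs_def code_even)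
    show "zadd 2 n x y \<in> ?C" if "x \<in> ?C" "y \<in> ?C" for x y
      using residue[OF code_linear[of x y 1 1]] that unfolding zadd_residue by simp
    show "zsmult 2 n a x \<in> ?C" if "x \<in> ?C" for a x
      using residue[OF code_linear[of x x a 0]] that unfolding zsmult_residue by simp
  qed auto
  then have sd: "self_dual 2 n ?C" using dual unfolding self_dual_def by simp
  have wt: "int (euclid_wt 2 n x) = dot n x x" if "x \<in> ?C" for x
  proof -
    have "int (euclid_wt (2 * 1) n x) = dot n x x"
      unfolding euclid_wt_lift[OF order_refl] dot_def
    proof (rule sum.cong[OF refl])
      fix i assume "i \<in> {..<n}"
      then have "x i = 0 \<or> x i = 1" using that unfolding zvecs_def by force
      then show "(lift 1 (x i))\<^sup>2 = x i * x i" unfolding lift_def by auto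
    qed
    then show ?thesis by simp
  qed
  show "extremal_type_II 1 n ?C"
  proof (rule extremal_type_II_I)
    show "self_dual (2 * 1) n ?C" using sd by simp
    show "4 * 1 dvd euclid_wt (2 * 1) n x" if "x \<in> ?C" for x
    proof -
      have "int 4 dvd int (euclid_wt 2 n x)" using wt[OF that] code_norm that by simp
      then show ?thesis by (simp only: int_dvd_int_iff mult_1_right)
    qed
    show "8 * 1 \<le> euclid_wt (2 * 1) n x" if x: "x \<in> ?C" "x \<noteq> (\<lambda>_. 0)" for x
    proof -
      obtain i where "x i \<noteq> 0" using x(2) by auto
      moreover from this have i: "i < n" using x(1) unfolding zvecs_def by (auto intro: ccontr)
      moreover have "0 \<le> x i" "x i < 2" using i x(1) unfolding zvecs_def by auto
      ultimately have "i < n" "odd (x i)" by presburger+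
      then have "8 \<le> card {i. i < n \<and> odd (x i)}" using code_min_weight x(1) by blast
      moreover have "int (card {i. i < n \<and> odd (x i)}) \<le> dot n x x"
        by (rule dot_self_ge_card) (auto intro: ccontr)
      ultimately show ?thesis using wt[OF x(1)] by simp
    qed
    have h0: "0 < h" using h_ge by simp
    let ?g = "residue_vec 2 n (gen 0)"
    have "?g 0 \<noteq> 0" unfolding residue_vec_def gen_def using h0 by simp
    then have "?g \<noteq> (\<lambda>_. 0)" by metis
    moreover have "int (euclid_wt (2 * 1) n ?g) \<le> dot n (gen 0) (gen 0)"
      using residue_vec_cong[of _ n 2 "gen 0"] by (intro euclid_wt_le_norm) auto
    then have "euclid_wt (2 * 1) n ?g \<le> 8 * 1" using gen_norm[OF h0] by simp
    ultimately show "\<exists>x\<in>?C. x \<noteq> (\<lambda>_. 0) \<and> euclid_wt (2 * 1) n x \<le> 8 * 1"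
      using residue[OF code_gen[OF h0]] by blast
  qed (use assms in auto)
qed

text \<open>
The code consists of the coordinate vectors phi x of the lattice vectors x modulo 2k, and it is self-dual
because the lattice is. Two lattice vectors of norm 4 with inner product 2 cannot both vanish modulo 2k,
which provides a codeword of weight 8k.
\<close>

lemma extremal_of_frame:
  assumes k: "2 \<le> k" and n: "n div 24 = 1"
    and rows: "\<And>r s. \<lbrakk>r < n; s < n\<rbrakk> \<Longrightarrow> dot n (H r) (H s) = (if r = s then 4 * int k else 0)"
    and cols: "\<And>i j. \<lbrakk>i < n; j < n\<rbrakk> \<Longrightarrow> (\<Sum>r<n. H r i * H r j) = (if i = j then 4 * int k else 0)"
    and lat: "\<And>r. r < n \<Longrightarrow> lattice (\<lambda>i. 2 * H r i)"
  shows "\<exists>C. extremal_type_II k n C"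
proof
  \<comment> \<open>The scaled inner product of x with the frame vector 2 H_r is 2 (H_r\<cdot>x)/8 =
    (H_r\<cdot>x)/4.\<close>
  define phi where "phi x r = dot n (H r) x div 4" for x r
  define C where "C = {c \<in> zvecs (2 * k) n. \<exists>x. lattice x \<and> (\<forall>r<n. 2 * int k dvd phi x r - c r)}"
  have phi: "dot n (H r) x = 4 * phi x r" if "lattice x" "r < n" for x r
  proof -
    have "8 dvd dot n (\<lambda>i. 2 * H r i) x" using lattice_dot[OF lat[OF that(2)] that(1)] .
    moreover have "dot n (\<lambda>i. 2 * H r i) x = 2 * dot n (H r) x"
      unfolding dot_def by (simp add: sum_distrib_left algebra_simps)
    ultimately show ?thesis unfolding phi_def by presburger
  qed
  \<comment> \<open>Orthogonality of the columns of H gives the sum of (H_r\<cdot>x)(H_r\<cdot>y) as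
    4k (x\<cdot>y); each factor is four times a coordinate.\<close>
  have parseval: "4 * dot n (phi x) (phi y) = int k * dot n x y" if "lattice x" "lattice y" for x y
  proof -
    have "16 * dot n (phi x) (phi y) = (\<Sum>r<n. dot n (H r) x * dot n (H r) y)"
      unfolding dot_def[of n "phi x"] sum_distrib_left using phi that by (intro sum.cong) auto
    also have "\<dots> = 4 * int k * dot n x y"
      using sum_bilinear[of n "\<lambda>i r. H r i" "4 * int k" x y] cols unfolding dot_def by simp
    finally show ?thesis by simp
  qed
  have phi_eqI: "phi v s = z" if "dot n (H s) v = 4 * z" for v s z
    unfolding phi_def that by simp
  have k0: "0 < 2 * k" using k by simp
  have res_cong: "2 * int k dvd z r - residue_vec (2 * k) n z r" if "r < n" for z r
    using residue_vec_cong[OF that, of "2 * k" z] by simp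
  have residue: "residue_vec (2 * k) n z \<in> C"
    if x: "lattice x" and z: "\<And>r. r < n \<Longrightarrow> 2 * int k dvd phi x r - z r" for x z
  proof -
    have "2 * int k dvd phi x r - residue_vec (2 * k) n z r" if r: "r < n" for r
      using dvd_add[OF z[OF r] res_cong[OF r, of z]] by simp
    then show ?thesis unfolding C_def using residue_vec_zvecs[OF k0] x by auto
  qed
  have code: "zcode (2 * k) n C" unfolding zcode_def
  proof (intro conjI ballI allI)
    show "C \<subseteq> zvecs (2 * k) n" unfolding C_def by auto
    have "phi (\<lambda>_. 0) r = 0" for r unfolding phi_def dot_def by simp
    then have "\<forall>r<n. 2 * int k dvd phi (\<lambda>_. 0) r - 0" by simp
    then show "(\<lambda>_. 0) \<in> C" unfolding C_def using lattice_zero k by (auto simp: zvecs_def)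
  next
    fix c d assume "c \<in> C" "d \<in> C"
    then obtain x y where x: "lattice x" "\<And>r. r < n \<Longrightarrow> 2 * int k dvd phi x r - c r"
      and y: "lattice y" "\<And>r. r < n \<Longrightarrow> 2 * int k dvd phi y r - d r" unfolding C_def by blast
    have "phi (\<lambda>i. 1 * x i + 1 * y i) r = phi x r + phi y r" if "r < n" for r
      by (rule phi_eqI) (use phi x(1) y(1) that in \<open>simp add: dot_linear(1)[of _ _ 1 _ 1, simplified]\<close>)
    then show "zadd (2 * k) n c d \<in> C"
      unfolding zadd_residue using x y dvd_add[OF x(2) y(2)]
      by (intro residue[OF lattice_linear[OF x(1) y(1), of 1 1]]) (simp add: algebra_simps)
  next
    fix a c assume "c \<in> C"
    then obtain x where x: "lattice x" "\<And>r. r < n \<Longrightarrow> 2 * int k dvd phi x r - c r"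
      unfolding C_def by blast
    have "phi (\<lambda>i. a * x i + 0 * x i) r = a * phi x r" if "r < n" for r
      by (rule phi_eqI) (use phi x(1) that in \<open>simp add: dot_linear(1)[of _ _ a _ 0, simplified]\<close>)
    then show "zsmult (2 * k) n a c \<in> C"
      unfolding zsmult_residue using x
      by (intro residue[OF lattice_linear[OF x(1) x(1), of a 0]])
        (simp add: right_diff_distrib[symmetric])
  qed
  have "C = zdual (2 * k) n C"
  proof
    show "C \<subseteq> zdual (2 * k) n C"
    proof
      fix c assume c: "c \<in> C"
      then obtain x where x: "lattice x" "\<And>r. r < n \<Longrightarrow> 2 * int k dvd phi x r - c r"
        unfolding C_def by blast
      have "(\<Sum>i<n. c i * d i) mod int (2 * k) = 0" if "d \<in> C" for d
      proof -
        obtain y where y: "lattice y" "\<And>r. r < n \<Longrightarrow> 2 * int k dvd phi y r - d r"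
          using \<open>d \<in> C\<close> unfolding C_def by blast
        have "2 * int k dvd dot n (phi x) (phi y) - dot n c d" using x y by (intro dvd_dot_diff)
        moreover obtain q where "dot n x y = 8 * q" using lattice_dot[OF x(1) y(1)] by blast
        then have "dot n (phi x) (phi y) = 2 * int k * q" using parseval[OF x(1) y(1)] by simp
        ultimately have "2 * int k dvd dot n c d"
          by (metis dvd_diff_right_iff dvd_triv_left)
        then show ?thesis unfolding dot_def by (simp add: dvd_eq_mod_eq_0)
      qed
      then show "c \<in> zdual (2 * k) n C" using c unfolding zdual_def C_def by blast
    qed
    show "zdual (2 * k) n C \<subseteq> C"
    proof
      fix c assume c: "c \<in> zdual (2 * k) n C"
      \<comment> \<open>The vector with frame coordinates c is Z/k. That Z is divisible by k, and
        that the quotient is in the lattice, both follow from the pairings of Z with the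
        lattice.\<close>
      define Z where "Z = (\<lambda>i. \<Sum>r<n. c r * H r i)"
      have Z: "8 * int k dvd dot n Z x" if x: "lattice x" for x
      proof -
        have "residue_vec (2 * k) n (phi x) \<in> C" using x by (intro residue) auto
        then have "(\<Sum>i<n. c i * residue_vec (2 * k) n (phi x) i) mod int (2 * k) = 0"
          using c unfolding zdual_def by blast
        then have "2 * int k dvd dot n c (residue_vec (2 * k) n (phi x))"
          unfolding dot_def by (simp add: dvd_eq_mod_eq_0)
        moreover have "2 * int k dvd dot n c (phi x) - dot n c (residue_vec (2 * k) n (phi x))"
          using res_cong by (intro dvd_dot_diff) auto
        ultimately have "2 * int k dvd dot n c (phi x)"
          by (metis dvd_add diff_add_cancel)
        then have "4 * (2 * int k) dvd 4 * dot n c (phi x)" by (rule mult_dvd_mono[OF dvd_refl])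
        moreover have "dot n x Z = 4 * dot n c (phi x)"
          unfolding Z_def dot_sum dot_def[of n c] sum_distrib_left dot_commute[of n x]
          using phi[OF x] by (intro sum.cong) auto
        then have "dot n Z x = 4 * dot n c (phi x)" by (simp only: dot_commute[of n Z])
        ultimately show ?thesis by (simp add: mult.assoc[symmetric])
      qed
      define v where "v = (\<lambda>i. Z i div int k)"
      have v: "Z i = int k * v i" if "i < n" for i
      proof -
        \<comment> \<open>The test vector is \<open>pair_vec i i\<close>, that is, 8 e_i.\<close>
        have "8 * int k dvd 8 * Z i"
          using Z[OF lattice_pair_vec[OF that that]] dot_pair_vec[OF that that, of Z] by simp
        then show ?thesis unfolding v_def by simp
      qed
      have dot_v: "dot n x Z = int k * dot n x v" for x
        unfolding dot_def sum_distrib_left using v by (intro sum.cong) auto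
      have "lattice v"
      proof (rule lattice_unimodular)
        fix x assume "lattice x"
        then have "int k * 8 dvd int k * dot n v x"
          using Z dot_v[of x] by (metis dot_commute mult.commute)
        then show "8 dvd dot n v x" using k by simp
      qed
      moreover have "phi v s = c s" if s: "s < n" for s
      proof (rule phi_eqI)
        have "int k * dot n (H s) v = (\<Sum>r<n. c r * dot n (H s) (H r))"
          unfolding dot_v[symmetric] Z_def dot_sum ..
        also have "\<dots> = (\<Sum>r<n. if r = s then 4 * int k * c s else 0)"
          using rows s by (intro sum.cong) auto
        also have "\<dots> = int k * (4 * c s)" using s by simp
        finally show "dot n (H s) v = 4 * c s" using k by simp
      qed
      moreover have "c \<in> zvecs (2 * k) n" using c unfolding zdual_def by simp
      ultimately show "c \<in> C" unfolding C_def by fastforce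
    qed
  qed
  then have sd: "self_dual (2 * k) n C" using code unfolding self_dual_def by simp
  have rep: "\<exists>v. lattice v \<and> (\<forall>r<n. 2 * int k dvd phi v r - c r)
    \<and> 4 * int (euclid_wt (2 * k) n c) = int k * dot n v v" if c: "c \<in> C" for c
  proof -
    obtain x where x: "lattice x" "\<And>r. r < n \<Longrightarrow> 2 * int k dvd phi x r - c r"
      using c unfolding C_def by blast
    \<comment> \<open>Adding t_r times the frame vector 2 H_r moves the r-th coordinate by 2k t_r.
      Hence some lattice vector has exactly the centred lifts as coordinates, and its norm
      determines the Euclidean weight.\<close>
    define t where "t r = (lift k (c r) - phi x r) div (2 * int k)" for r
    have t: "lift k (c r) = phi x r + 2 * int k * t r" if "r < n" for r
    proof -
      have "2 * int k dvd lift k (c r) - phi x r"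
        using dvd_diff[OF lift_cong[of k "c r"] x(2)[OF that]] by simp
      then show ?thesis unfolding t_def by simp
    qed
    define v where "v = (\<lambda>i. 1 * x i + 1 * (\<Sum>r<n. t r * (2 * H r i)))"
    have v: "lattice v" unfolding v_def using x(1) lat by (intro lattice_linear lattice_sum) auto
    have phi_v: "phi v s = lift k (c s)" if s: "s < n" for s
    proof (rule phi_eqI)
      have "dot n (H s) v = 4 * phi x s + (\<Sum>r<n. t r * dot n (H s) (\<lambda>i. 2 * H r i))"
        unfolding v_def dot_linear dot_sum using phi[OF x(1) s] by simp
      also have "(\<Sum>r<n. t r * dot n (H s) (\<lambda>i. 2 * H r i)) = (\<Sum>r<n. if r = s then 8 * int k * t s else 0)"
      proof (rule sum.cong[OF refl])
        fix r assume "r \<in> {..<n}"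
        moreover have "dot n (H s) (\<lambda>i. 2 * H r i) = 2 * dot n (H s) (H r)"
          unfolding dot_def by (simp add: sum_distrib_left algebra_simps)
        ultimately show "t r * dot n (H s) (\<lambda>i. 2 * H r i) = (if r = s then 8 * int k * t s else 0)"
          using rows s by simp
      qed
      also have "\<dots> = 8 * int k * t s" using s by simp
      finally show "dot n (H s) v = 4 * lift k (c s)" using t[OF s] by simp
    qed
    have "int (euclid_wt (2 * k) n c) = dot n (phi v) (phi v)"
      using k phi_v unfolding dot_def
      by (subst euclid_wt_lift) (auto intro!: sum.cong simp: power2_eq_square)
    then have "4 * int (euclid_wt (2 * k) n c) = int k * dot n v v" using parseval[OF v v] by simp
    then show ?thesis using v phi_v lift_cong by metis
  qed
  show "extremal_type_II k n C"
  proof (rule extremal_type_II_I[OF _ n sd])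
    show "1 \<le> k" using k by simp
    fix c assume c: "c \<in> C"
    obtain v where v: "lattice v" "\<And>r. r < n \<Longrightarrow> 2 * int k dvd phi v r - c r"
      "4 * int (euclid_wt (2 * k) n c) = int k * dot n v v" using rep[OF c] by blast
    obtain q where q: "dot n v v = 16 * q" using lattice_norm[OF v(1)] by blast
    have wt: "int (euclid_wt (2 * k) n c) = int (4 * k) * q" using v(3) q by simp
    then have "int (4 * k) dvd int (euclid_wt (2 * k) n c)" by simp
    then show "4 * k dvd euclid_wt (2 * k) n c" by (simp only: int_dvd_int_iff)
    assume "c \<noteq> (\<lambda>_. 0)"
    moreover have zv: "c \<in> zvecs (2 * k) n" using c unfolding C_def by simp
    moreover have "(\<lambda>_. 0) \<in> zvecs (2 * k) n" using k by (simp add: zvecs_def)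
    ultimately obtain r where r: "r < n" "\<not> 2 * int k dvd c r"
      using zvecs_eqI[of c "2 * k" n "\<lambda>_. 0"] by auto
    have "phi v r \<noteq> 0" using v(2)[OF r(1)] r(2) by auto
    then have "\<exists>i<n. v i \<noteq> 0"
      using phi[OF v(1) r(1)] unfolding dot_def by (metis (no_types, lifting) lessThan_iff mult_eq_0_iff sum.neutral zero_neq_numeral)
    then have "32 \<le> dot n v v" using lattice_min_norm[OF v(1)] by blast
    then have "int (4 * k) * 2 \<le> int (4 * k) * q" using q by (intro mult_left_mono) auto
    then show "8 * k \<le> euclid_wt (2 * k) n c" using wt by linarith
  next
    have idx: "0 < n" "1 < n" "2 < n" using h_ge by simp_all
    have small: "euclid_wt (2 * k) n (residue_vec (2 * k) n (phi (pair_vec 0 j))) \<le> 8 * k"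
      if "j \<in> {1, 2}" for j
    proof -
      have j: "j < n" using that idx by auto
      have "dot n (pair_vec 0 j) (pair_vec 0 j) = 32"
        using that dot_pair_vec[OF idx(1) j, of "pair_vec 0 j"] by (auto simp: pair_vec_def)
      then have "dot n (phi (pair_vec 0 j)) (phi (pair_vec 0 j)) = 8 * int k"
        using parseval[OF lattice_pair_vec[OF idx(1) j] lattice_pair_vec[OF idx(1) j]] by simp
      moreover have "int (euclid_wt (2 * k) n (residue_vec (2 * k) n (phi (pair_vec 0 j))))
        \<le> dot n (phi (pair_vec 0 j)) (phi (pair_vec 0 j))"
        using k res_cong by (intro euclid_wt_le_norm) (auto simp: dvd_diff_commute)
      ultimately show ?thesis by linarith
    qed
    have mem: "residue_vec (2 * k) n (phi (pair_vec 0 j)) \<in> C" if "j \<in> {1, 2}" for j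
      using that idx by (intro residue[of "pair_vec 0 j"] lattice_pair_vec) auto
    have "\<exists>j\<in>{1, 2}. residue_vec (2 * k) n (phi (pair_vec 0 j)) \<noteq> (\<lambda>_. 0)"
    proof (rule ccontr)
      assume "\<not> ?thesis"
      then have z: "2 * int k dvd phi (pair_vec 0 1) r" "2 * int k dvd phi (pair_vec 0 2) r" if "r < n" for r
        using that residue_vec_eq_0[of "2 * k" n] by auto
      \<comment> \<open>If both words vanished, 4k^2 would divide the inner product of the
        coordinate vectors, which is 4k; this is impossible for k at least 2.\<close>
      have "(2 * int k) * (2 * int k) dvd dot n (phi (pair_vec 0 1)) (phi (pair_vec 0 2))"
        unfolding dot_def using z by (intro dvd_sum mult_dvd_mono) auto
      moreover have "dot n (pair_vec 0 1) (pair_vec 0 2) = 16"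
        using dot_pair_vec[OF idx(1) idx(3), of "pair_vec 0 1"] by (simp add: pair_vec_def)
      then have "dot n (phi (pair_vec 0 1)) (phi (pair_vec 0 2)) = 4 * int k"
        using parseval[OF lattice_pair_vec[OF idx(1,2)] lattice_pair_vec[OF idx(1,3)]] by simp
      ultimately have "(4 * int k) * int k dvd (4 * int k) * 1" by (simp add: algebra_simps)
      then have "int k dvd 1" using k by (subst (asm) dvd_mult_cancel_left) auto
      then show False using k by simp
    qed
    then show "\<exists>x\<in>C. x \<noteq> (\<lambda>_. 0) \<and> euclid_wt (2 * k) n x \<le> 8 * k" using small mem by blast
  qed
qed

end

section \<open>Quaternionic frames\<close>

text \<open>Here the columns, not the rows, are the products q e_f. The opposite convention of
  \<open>right_mult\<close> is harmless: transposing a right multiplication gives right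
  multiplication by the conjugate, which still commutes with left multiplications.\<close>

definition left_mult :: "int \<Rightarrow> int \<Rightarrow> int \<Rightarrow> int \<Rightarrow> nat \<Rightarrow> nat \<Rightarrow> int" where
  "left_mult a b c d e f = [[a, -b, -c, -d], [b, a, -d, c], [c, d, a, -b], [d, -c, b, a]] ! e ! f"

text \<open>Row e of the matrix holds the coordinates of the product of the e-th basis quaternion with t.\<close>

definition right_mult :: "int \<times> int \<times> int \<times> int \<Rightarrow> nat \<Rightarrow> nat \<Rightarrow> int" where
  "right_mult t e f = (case t of (a, b, c, d) \<Rightarrow>
     [[a, b, c, d], [-b, a, -d, c], [-c, d, a, -b], [-d, -c, b, a]] ! e ! f)"

definition quat_left :: "int \<Rightarrow> int \<Rightarrow> int \<Rightarrow> int \<Rightarrow> nat \<Rightarrow> nat \<Rightarrow> int" where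
  "quat_left a b c d r i = (if r div 4 = i div 4 then left_mult a b c d (r mod 4) (i mod 4) else 0)"

definition quat_right :: "(nat \<Rightarrow> nat \<Rightarrow> int \<times> int \<times> int \<times> int) \<Rightarrow> nat \<Rightarrow> nat \<Rightarrow> int" where
  "quat_right Q r i = right_mult (Q (r div 4) (i div 4)) (r mod 4) (i mod 4)"

lemma sum_blocks4:
  fixes f :: "nat \<Rightarrow> int"
  shows "(\<Sum>i<4 * m. f i) = (\<Sum>p<m. \<Sum>e\<in>{0,1,2,3}. f (4 * p + e))"
proof (induction m)
  case (Suc m)
  have "{..<4 * Suc m} = {..<4 * m} \<union> {4 * m, 4 * m + 1, 4 * m + 2, 4 * m + 3}" by auto
  then show ?case using Suc by simp
qed simp

lemma block_index:
  fixes r :: nat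
  assumes "r < 4 * m"
  obtains p e where "p < m" "e \<in> {0,1,2,3}" "r = 4 * p + e"
proof
  show "r div 4 < m" using assms by linarith
  have "r mod 4 < 4" by simp
  then show "r mod 4 \<in> {0,1,2,3}" by (simp only: insert_iff empty_iff) linarith
  show "r = 4 * (r div 4) + r mod 4" by simp
qed

lemma quat_left_block:
  assumes "e \<in> {0,1,2,3}" "f \<in> {0,1,2,3}"
  shows "quat_left a b c d (4 * p + e) (4 * q + f) = (if p = q then left_mult a b c d e f else 0)"
proof -
  have "(4 * p + e) div 4 = p" "(4 * q + f) div 4 = q" "(4 * p + e) mod 4 = e" "(4 * q + f) mod 4 = f"
    using assms by auto
  then show ?thesis unfolding quat_left_def by simp
qed

lemma quat_right_block:
  assumes "e \<in> {0,1,2,3}" "f \<in> {0,1,2,3}"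
  shows "quat_right Q (4 * p + e) (4 * q + f) = right_mult (Q p q) e f"
proof -
  have "(4 * p + e) div 4 = p" "(4 * q + f) div 4 = q" "(4 * p + e) mod 4 = e" "(4 * q + f) mod 4 = f"
    using assms by auto
  then show ?thesis unfolding quat_right_def by simp
qed

lemma block_index_eq_iff:
  fixes p q e f :: nat
  assumes "e \<in> {0,1,2,3}" "f \<in> {0,1,2,3}"
  shows "4 * p + e = 4 * q + f \<longleftrightarrow> p = q \<and> e = f"
  using assms by auto presburger+

lemma sum_quat_left:
  assumes "p < m" "e \<in> {0,1,2,3}"
  shows "(\<Sum>i<4 * m. quat_left a b c d (4 * p + e) i * g i)
    = (\<Sum>f\<in>{0,1,2,3}. left_mult a b c d e f * g (4 * p + f))"
proof -
  have "(\<Sum>i<4 * m. quat_left a b c d (4 * p + e) i * g i)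
    = (\<Sum>q<m. if q = p then \<Sum>f\<in>{0,1,2,3}. left_mult a b c d e f * g (4 * p + f) else 0)"
    unfolding sum_blocks4
  proof (rule sum.cong[OF refl])
    fix q
    have "(\<Sum>f\<in>{0,1,2,3}. quat_left a b c d (4 * p + e) (4 * q + f) * g (4 * q + f))
      = (\<Sum>f\<in>{0,1,2,3}. (if p = q then left_mult a b c d e f else 0) * g (4 * q + f))"
      by (rule sum.cong) (simp_all only: quat_left_block[OF assms(2)])
    then show "(\<Sum>f\<in>{0,1,2,3}. quat_left a b c d (4 * p + e) (4 * q + f) * g (4 * q + f))
      = (if q = p then \<Sum>f\<in>{0,1,2,3}. left_mult a b c d e f * g (4 * p + f) else 0)" by simp
  qed
  then show ?thesis using assms(1) by simp
qed

lemma left_mult_transpose: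
  assumes "e \<in> {0,1,2,3}" "f \<in> {0,1,2,3}"
  shows "left_mult a b c d e f = left_mult a (-b) (-c) (-d) f e"
  using assms by (auto simp: left_mult_def numeral_2_eq_2 numeral_3_eq_3)

lemma quat_left_transpose: "quat_left a b c d r i = quat_left a (-b) (-c) (-d) i r"
proof -
  have "r mod 4 \<in> {0,1,2,3}" "i mod 4 \<in> {0,1,2,3}" by (simp_all only: insert_iff empty_iff) linarith+
  from left_mult_transpose[OF this, of a b c d] show ?thesis unfolding quat_left_def by simp
qed

lemma left_mult_dot:
  assumes "e \<in> {0,1,2,3}" "f \<in> {0,1,2,3}"
  shows "(\<Sum>g\<in>{0,1,2,3}. left_mult a b c d e g * left_mult a b c d f g)
    = (if e = f then a\<^sup>2 + b\<^sup>2 + c\<^sup>2 + d\<^sup>2 else 0)"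
  using assms by (auto simp: left_mult_def numeral_2_eq_2 numeral_3_eq_3 power2_eq_square)

text \<open>Associativity of quaternions. On the right the left multiplication is transposed into
  its conjugate, so that both sides run along one of its rows and fit
  \<open>sum_quat_left\<close>.\<close>

lemma left_right_mult_commute:
  assumes "e \<in> {0,1,2,3}" "f \<in> {0,1,2,3}"
  shows "(\<Sum>g\<in>{0,1,2,3}. left_mult a b c d e g * right_mult t g f)
    = (\<Sum>g\<in>{0,1,2,3}. left_mult a (-b) (-c) (-d) f g * right_mult t e g)"
  using assms by (cases t) (auto simp: left_mult_def right_mult_def numeral_2_eq_2 numeral_3_eq_3)

lemma quat_left_dot:
  assumes "r < 4 * m" "s < 4 * m"
  shows "(\<Sum>i<4 * m. quat_left a b c d r i * quat_left a b c d s i)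
    = (if r = s then a\<^sup>2 + b\<^sup>2 + c\<^sup>2 + d\<^sup>2 else 0)"
proof -
  obtain p e where r: "p < m" "e \<in> {0,1,2,3}" "r = 4 * p + e" using block_index[OF assms(1)] .
  obtain q f where s: "q < m" "f \<in> {0,1,2,3}" "s = 4 * q + f" using block_index[OF assms(2)] .
  have "(\<Sum>i<4 * m. quat_left a b c d r i * quat_left a b c d s i)
    = (\<Sum>g\<in>{0,1,2,3}. left_mult a b c d e g * (if q = p then left_mult a b c d f g else 0))"
    unfolding r(3) s(3) sum_quat_left[OF r(1,2)]
    by (rule sum.cong) (simp_all only: quat_left_block[OF s(2)])
  also have "\<dots> = (if q = p then \<Sum>g\<in>{0,1,2,3}. left_mult a b c d e g * left_mult a b c d f g else 0)"
    by simp
  finally show ?thesis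
    unfolding left_mult_dot[OF r(2) s(2)] r(3) s(3) block_index_eq_iff[OF r(2) s(2)] by auto
qed

lemma quat_left_right_commute:
  assumes "r < 4 * m" "s < 4 * m"
  shows "(\<Sum>i<4 * m. quat_left a b c d r i * quat_right Q i s)
    = (\<Sum>i<4 * m. quat_right Q r i * quat_left a b c d i s)"
proof -
  obtain p e where r: "p < m" "e \<in> {0,1,2,3}" "r = 4 * p + e" using block_index[OF assms(1)] .
  obtain q f where s: "q < m" "f \<in> {0,1,2,3}" "s = 4 * q + f" using block_index[OF assms(2)] .
  have "(\<Sum>i<4 * m. quat_left a b c d r i * quat_right Q i s)
    = (\<Sum>g\<in>{0,1,2,3}. left_mult a b c d e g * right_mult (Q p q) g f)"
    unfolding r(3) s(3) sum_quat_left[OF r(1,2)]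
    by (rule sum.cong) (simp_all only: quat_right_block[OF _ s(2)])
  also have "\<dots> = (\<Sum>g\<in>{0,1,2,3}. left_mult a (-b) (-c) (-d) f g * right_mult (Q p q) e g)"
    by (rule left_right_mult_commute[OF r(2) s(2)])
  also have "\<dots> = (\<Sum>i<4 * m. quat_left a (-b) (-c) (-d) s i * quat_right Q r i)"
    unfolding r(3) s(3) sum_quat_left[OF s(1,2)]
    by (rule sum.cong) (simp_all only: quat_right_block[OF r(2)])
  also have "\<dots> = (\<Sum>i<4 * m. quat_right Q r i * quat_left a b c d i s)"
    by (simp only: quat_left_transpose[of a b c d _ s] mult.commute)
  finally show ?thesis .
qed

section \<open>Block frames and their membership in the lattice\<close>

definition frame :: "nat \<Rightarrow> (nat \<Rightarrow> nat \<Rightarrow> int) \<Rightarrow> int \<Rightarrow> int \<Rightarrow> int \<Rightarrow> int \<Rightarrow> nat \<Rightarrow> nat \<Rightarrow> int" where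
  "frame h T a b c d r i =
     (if r < h then if i < h then quat_left a b c d r i else T r (i - h)
      else if i < h then - T i (r - h) else quat_left a (-b) (-c) (-d) (r - h) (i - h))"

text \<open>The transpose is a frame for the conjugate of q and -T, so orthogonality of the columns
  follows from that of the rows.\<close>

lemma frame_transpose: "frame h T a b c d r i = frame h (\<lambda>i j. - T i j) a (-b) (-c) (-d) i r"
  unfolding frame_def using quat_left_transpose[of a b c d] quat_left_transpose[of a "-b" "-c" "-d"] by simp

text \<open>The diagonal blocks of the Gram matrix are L L^t + T T^t and T^t T + L^t L; the
  off-diagonal block is T L - L T, which vanishes.\<close>

lemma frame_dot:
  assumes h: "h = 4 * m"
    and row_dot: "\<And>i j. \<lbrakk>i < h; j < h\<rbrakk> \<Longrightarrow> (\<Sum>l<h. T i l * T j l) = (if i = j then e else 0)"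
    and col_dot: "\<And>i j. \<lbrakk>i < h; j < h\<rbrakk> \<Longrightarrow> (\<Sum>l<h. T l i * T l j) = (if i = j then e else 0)"
    and commute: "\<And>a b c d i j. \<lbrakk>i < h; j < h\<rbrakk> \<Longrightarrow>
      (\<Sum>l<h. quat_left a b c d i l * T l j) = (\<Sum>l<h. T i l * quat_left a b c d l j)"
    and "r < 2 * h" "s < 2 * h"
  shows "dot (2 * h) (frame h T a b c d r) (frame h T a b c d s)
    = (if r = s then a\<^sup>2 + b\<^sup>2 + c\<^sup>2 + d\<^sup>2 + e else 0)"
proof -
  have cross: "dot (2 * h) (frame h T a b c d i) (frame h T a b c d (h + j)) = 0" if "i < h" "j < h" for i j
  proof -
    have "dot (2 * h) (frame h T a b c d i) (frame h T a b c d (h + j))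
      = (\<Sum>l<h. T i l * quat_left a b c d l j) - (\<Sum>l<h. quat_left a b c d i l * T l j)"
      unfolding dot_def sum_lessThan_double frame_def
      using that quat_left_transpose[of a b c d _ j] by (simp add: sum_negf)
    then show ?thesis using commute[OF that] by simp
  qed
  have top: "dot (2 * h) (frame h T a b c d i) (frame h T a b c d j)
    = (if i = j then a\<^sup>2 + b\<^sup>2 + c\<^sup>2 + d\<^sup>2 + e else 0)" if "i < h" "j < h" for i j
    unfolding dot_def sum_lessThan_double frame_def
    using that quat_left_dot[of i m j a b c d] h row_dot[OF that] by simp
  have bot: "dot (2 * h) (frame h T a b c d (h + i)) (frame h T a b c d (h + j))
    = (if i = j then a\<^sup>2 + b\<^sup>2 + c\<^sup>2 + d\<^sup>2 + e else 0)" if "i < h" "j < h" for i j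
    unfolding dot_def sum_lessThan_double frame_def
    using that quat_left_dot[of i m j a "-b" "-c" "-d"] h col_dot[OF that] by simp
  from assms(5) show ?thesis
  proof (cases rule: less_double_cases)
    case r: 1
    from assms(6) show ?thesis
    proof (cases rule: less_double_cases)
      case 1
      then show ?thesis using top r by simp
    next
      case (2 j)
      then show ?thesis using cross[of r j] r by simp
    qed
  next
    case r: (2 i)
    from assms(6) show ?thesis
    proof (cases rule: less_double_cases)
      case 1
      then show ?thesis using cross[of s i] r dot_commute[of "2 * h" "frame h T a b c d r"] by simp
    next
      case (2 j)
      then show ?thesis using bot[of i j] r by simp
    qed
  qed
qed

lemma quat_left_double:
  "quat_left (1 + 2*a) (2*b) (2*c) (2*d) r i = (if r = i then 1 else 0) + 2 * quat_left a b c d r i"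
proof -
  have "left_mult (1 + 2*a) (2*b) (2*c) (2*d) e f = (if e = f then 1 else 0) + 2 * left_mult a b c d e f"
    if "e \<in> {0,1,2,3}" "f \<in> {0,1,2,3}" for e f
    using that by (auto simp: left_mult_def numeral_2_eq_2 numeral_3_eq_3)
  moreover have "r mod 4 \<in> {0,1,2,3}" "i mod 4 \<in> {0,1,2,3}"
    by (simp_all only: insert_iff empty_iff) linarith+
  moreover have "r = i \<longleftrightarrow> r div 4 = i div 4 \<and> r mod 4 = i mod 4" by (metis div_mult_mod_eq)
  ultimately show ?thesis unfolding quat_left_def by simp
qed

text \<open>The matrix is I + 2 L with L the left multiplication by (a, b, c, d). Row sums of L have
  the parity of a + b + c + d, and odd weights do not change it, so the remaining term is twice an
  even number.\<close>

lemma quat_left_weighted_sum: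
  assumes "r < 4 * m" "\<And>i. i < 4 * m \<Longrightarrow> odd (w i)" "even (a + b + c + d)"
  shows "4 dvd (\<Sum>i<4 * m. quat_left (1 + 2*a) (2*b) (2*c) (2*d) r i * w i) - w r"
proof -
  obtain p e where r: "p < m" "e \<in> {0,1,2,3}" "r = 4 * p + e" using block_index[OF assms(1)] .
  have "(\<Sum>i<4 * m. quat_left (1 + 2*a) (2*b) (2*c) (2*d) r i * w i)
    = (\<Sum>i<4 * m. if i = r then w r else 0) + 2 * (\<Sum>i<4 * m. quat_left a b c d r i * w i)"
    unfolding sum_distrib_left sum.distrib[symmetric] quat_left_double
    by (rule sum.cong) (auto simp: algebra_simps)
  then have eq: "(\<Sum>i<4 * m. quat_left (1 + 2*a) (2*b) (2*c) (2*d) r i * w i) - w r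
    = 2 * (\<Sum>i<4 * m. quat_left a b c d r i * w i)" using assms(1) by simp
  have "even (\<Sum>f\<in>{0,1,2,3}. left_mult a b c d e f * w (4 * p + f))"
  proof -
    have "even (\<Sum>f\<in>{0,1,2,3}. left_mult a b c d e f * (w (4 * p + f) - 1))"
      using r(1) assms(2) by (intro dvd_sum dvd_mult) auto
    moreover have "even (\<Sum>f\<in>{0,1,2,3}. left_mult a b c d e f)"
      using assms(3) r(2) by (auto simp: left_mult_def numeral_2_eq_2 numeral_3_eq_3)
    ultimately show ?thesis by (simp only: right_diff_distrib sum_subtractf mult_1_right even_diff) auto
  qed
  then have "even (\<Sum>i<4 * m. quat_left a b c d r i * w i)" unfolding r(3) sum_quat_left[OF r(1,2)] .
  then show ?thesis unfolding eq by (elim evenE) simp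
qed

lemma quat_left_odd: "even (quat_left (1 + 2*a) (2*b) (2*c) (2*d) r i - (if r = i then 1 else 0))"
  unfolding quat_left_double by simp

locale quaternionic_weighing_code = weighing_code h "quat_right Q" w
  for h Q w +
  fixes m assumes h_eq: "h = 4 * m"
begin

abbreviation T where "T \<equiv> quat_right Q"

text \<open>Modulo 2 the rows are those of [I | T] or [T^t | I], hence codewords. Modulo 4 the
  diagonal block acts on w like the identity, so \<open>w_row\<close> and \<open>w_col\<close> give
  the condition on w.\<close>

lemma lattice_frame:
  assumes q: "even (a + b + c + d)" and r: "r < n"
  shows "lattice (\<lambda>i. 2 * frame h T (1 + 2*a) (2*b) (2*c) (2*d) r i)"
  using r
proof (cases rule: less_double_cases)
  case 1
  let ?f = "frame h T (1 + 2*a) (2*b) (2*c) (2*d) r"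
  show ?thesis
  proof (rule lattice_even)
    show "code ?f"
    proof (rule code_cong[OF code_gen[OF 1]])
      fix i assume "i < n"
      show "even (gen r i - ?f i)"
        using quat_left_odd[of a b c d r i] 1 unfolding gen_def frame_def by auto
    qed
    have "dot n w ?f = (\<Sum>i<h. quat_left (1 + 2*a) (2*b) (2*c) (2*d) r i * w i) + (\<Sum>i<h. T r i * w (h + i))"
      unfolding dot_def sum_lessThan_double frame_def using 1 by (simp add: mult.commute)
    moreover have "4 dvd (\<Sum>i<h. quat_left (1 + 2*a) (2*b) (2*c) (2*d) r i * w i) - w r"
      using q w_odd 1 unfolding h_eq by (intro quat_left_weighted_sum) auto
    ultimately show "4 dvd dot n w ?f" using w_row[OF 1] by presburger
  qed simp
next
  case (2 s)
  let ?f = "frame h T (1 + 2*a) (2*b) (2*c) (2*d) r"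
  show ?thesis
  proof (rule lattice_even)
    show "code ?f"
    proof (rule code_cong)
      \<comment> \<open>Row s of [-T^t | I]; by T^t T = 7 I its defect in the code equations is 8 or
        0.\<close>
      let ?y = "\<lambda>i. if i < h then - T i s else if i - h = s then 1 else 0"
      show "code ?y" unfolding code_def
      proof (intro allI impI)
        fix j assume j: "j < h"
        have "?y (h + j) - (\<Sum>i<h. T i j * ?y i) = (if j = s then 1 else 0) + (\<Sum>i<h. T i j * T i s)"
          by (simp add: sum_negf)
        also have "\<dots> = (if j = s then 8 else 0)" unfolding col_dot[OF j 2(1)] by simp
        finally show "even (?y (h + j) - (\<Sum>i<h. T i j * ?y i))" by (rule ssubst) simp
      qed
      fix i assume "i < n"
      show "even (?y i - ?f i)"
        using quat_left_odd[of a "-b" "-c" "-d" s "i - h"] 2 unfolding frame_def by auto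
    qed
    have "dot n w ?f = (\<Sum>i<h. quat_left (1 + 2*a) (2*(-b)) (2*(-c)) (2*(-d)) s i * w (h + i)) - (\<Sum>i<h. T i s * w i)"
      unfolding dot_def sum_lessThan_double frame_def using 2 by (simp add: mult.commute sum_negf)
    moreover have "4 dvd (\<Sum>i<h. quat_left (1 + 2*a) (2*(-b)) (2*(-c)) (2*(-d)) s i * w (h + i)) - w (h + s)"
      using q w_odd 2 quat_left_weighted_sum[of s m "\<lambda>i. w (h + i)" a "-b" "-c" "-d"]
      unfolding h_eq by auto
    ultimately show "4 dvd dot n w ?f" using w_col[OF 2(1)] by presburger
  qed simp
qed

lemma extremal_exists:
  assumes k: "1 \<le> k" and n: "n div 24 = 1"
  shows "\<exists>C. extremal_type_II k n C"
proof (cases "k = 1")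
  case True
  then show ?thesis using extremal_binary[OF n] by simp
next
  case False
  then have k2: "2 \<le> k" using k by simp
  obtain a b c d :: int where
    q: "(1 + 2*a)\<^sup>2 + (2*b)\<^sup>2 + (2*c)\<^sup>2 + (2*d)\<^sup>2 = 4 * int (k - 2) + 1" and e: "even (a + b + c + d)"
    using four_squares_one_mod_four .
  have norm: "(1 + 2*a)\<^sup>2 + (2*b)\<^sup>2 + (2*c)\<^sup>2 + (2*d)\<^sup>2 + 7 = 4 * int k" using q k2 by simp
  have commute: "(\<Sum>l<h. quat_left a b c d i l * T l j) = (\<Sum>l<h. T i l * quat_left a b c d l j)"
    if "i < h" "j < h" for a b c d i j
    using quat_left_right_commute that unfolding h_eq .
  let ?H = "frame h T (1 + 2*a) (2*b) (2*c) (2*d)"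
  show ?thesis
  proof (rule extremal_of_frame[OF k2 n])
    show "dot n (?H r) (?H s) = (if r = s then 4 * int k else 0)" if "r < n" "s < n" for r s
      unfolding norm[symmetric] using that by (intro frame_dot[OF h_eq] row_dot col_dot commute)
    show "(\<Sum>r<n. ?H r i * ?H r j) = (if i = j then 4 * int k else 0)" if "i < n" "j < n" for i j
    proof -
      let ?H' = "frame h (\<lambda>i j. - T i j) (1 + 2*a) (- (2*b)) (- (2*c)) (- (2*d))"
      have "(\<Sum>r<n. ?H r i * ?H r j) = dot n (?H' i) (?H' j)"
        unfolding dot_def by (simp only: frame_transpose[of h T "1 + 2*a" "2*b" "2*c" "2*d"])
      also have "\<dots> = (if i = j then (1 + 2*a)\<^sup>2 + (- (2*b))\<^sup>2 + (- (2*c))\<^sup>2 + (- (2*d))\<^sup>2 + 7 else 0)"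
        using that by (intro frame_dot[OF h_eq]) (simp_all add: row_dot col_dot commute sum_negf)
      finally show ?thesis using norm by simp
    qed
    show "lattice (\<lambda>i. 2 * ?H r i)" if "r < n" for r using lattice_frame[OF e that] .
  qed
qed

end

section \<open>The codes of lengths 32 and 40\<close>

definition list_dot :: "int list \<Rightarrow> int list \<Rightarrow> int" where
  "list_dot xs ys = sum_list (map2 (*) xs ys)"

definition entries :: "nat \<Rightarrow> (nat \<Rightarrow> nat \<Rightarrow> int) \<Rightarrow> int list list" where
  "entries h T = map (\<lambda>i. map (T i) [0..<h]) [0..<h]"

definition orthogonal_rows :: "int list list \<Rightarrow> bool" where
  "orthogonal_rows M \<longleftrightarrow> list_all (\<lambda>i. list_all (\<lambda>j.
     list_dot (M ! i) (M ! j) = (if i = j then 7 else 0)) [0..<length M]) [0..<length M]"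

text \<open>N stands for the transpose of M, and u, v for the two halves of w.\<close>

definition weighing_check :: "int list list \<Rightarrow> int list list \<Rightarrow> int list \<Rightarrow> int list \<Rightarrow> bool" where
  "weighing_check M N u v \<longleftrightarrow> orthogonal_rows M \<and> orthogonal_rows N
     \<and> list_all (list_all (\<lambda>x. \<bar>x\<bar> \<le> 1)) M
     \<and> list_all (\<lambda>i. list_all (\<lambda>j. i = j \<or> 3 \<le> length (filter odd (map2 (+) (M ! i) (M ! j))))
          [0..<length M]) [0..<length M]
     \<and> list_all odd u \<and> list_all odd v \<and> 16 dvd list_dot u u + list_dot v v
     \<and> list_all (\<lambda>i. 4 dvd u ! i + list_dot (M ! i) v) [0..<length M]
     \<and> list_all (\<lambda>i. 4 dvd v ! i - list_dot (N ! i) u) [0..<length M]"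

lemma list_dot_map: "list_dot (map f [0..<h]) (map g [0..<h]) = (\<Sum>i<h. f i * g i)"
  unfolding list_dot_def
  by (simp add: map2_map_map interv_sum_list_conv_sum_set_nat atLeast0LessThan)

lemma entries_nth: "i < h \<Longrightarrow> entries h T ! i = map (T i) [0..<h]"
  unfolding entries_def by simp

lemma length_entries: "length (entries h T) = h"
  unfolding entries_def by simp

lemma orthogonal_rowsD:
  assumes "orthogonal_rows (entries h T)" "i < h" "j < h"
  shows "(\<Sum>l<h. T i l * T j l) = (if i = j then 7 else 0)"
  using assms unfolding orthogonal_rows_def length_entries list_all_iff
  by (auto simp: entries_nth list_dot_map)

lemma weighing_code_checkI:
  assumes h: "16 \<le> h"
    and check: "weighing_check (entries h T) (entries h (\<lambda>i j. T j i))
      (map w [0..<h]) (map (\<lambda>i. w (h + i)) [0..<h])"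
  shows "weighing_code h T w"
proof
  show "16 \<le> h" by (rule h)
  show "(\<Sum>l<h. T i l * T j l) = (if i = j then 7 else 0)" if "i < h" "j < h" for i j
    using orthogonal_rowsD[OF _ that, of T] check unfolding weighing_check_def by blast
  show "(\<Sum>l<h. T l i * T l j) = (if i = j then 7 else 0)" if "i < h" "j < h" for i j
    using orthogonal_rowsD[OF _ that, of "\<lambda>i j. T j i"] check unfolding weighing_check_def by blast
  show "\<bar>T i j\<bar> \<le> 1" if "i < h" "j < h" for i j
    using check that unfolding weighing_check_def entries_def by (simp add: list_all_iff)
  show "3 \<le> card {l. l < h \<and> odd (T i l + T j l)}" if "i < h" "j < h" "i \<noteq> j" for i j
  proof -
    have "\<forall>i<h. \<forall>j<h. i = j \<or> 3 \<le> length (filter odd (map2 (+) (entries h T ! i) (entries h T ! j)))"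
      using check unfolding weighing_check_def length_entries list_all_iff by simp
    then have "3 \<le> length (filter odd (map2 (+) (entries h T ! i) (entries h T ! j)))"
      using that by blast
    also have "\<dots> = length (filter (\<lambda>l. odd (T i l + T j l)) [0..<h])"
      using that by (simp add: entries_nth map2_map_map filter_map o_def)
    also have "\<dots> = card {l. l < h \<and> odd (T i l + T j l)}"
      by (subst distinct_card[symmetric]) (auto intro: arg_cong[where f = card])
    finally show ?thesis .
  qed
  show "odd (w i)" if "i < 2 * h" for i
    using that check unfolding weighing_check_def list_all_iff
    by (cases rule: less_double_cases) auto
  show "16 dvd dot (2 * h) w w"
    using check unfolding weighing_check_def list_dot_map dot_def sum_lessThan_double by blast
  show "4 dvd w i + (\<Sum>l<h. T i l * w (h + l))" if "i < h" for i
    using check that unfolding weighing_check_def length_entries list_all_iff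
    by (auto simp: entries_nth list_dot_map)
  show "4 dvd w (h + i) - (\<Sum>l<h. T l i * w l)" if "i < h" for i
    using check that unfolding weighing_check_def length_entries list_all_iff
    by (auto simp: entries_nth list_dot_map)
qed

text \<open>Let p = -1 - i + j - k, of norm 4. Rows have norm 4 + 3 = 7. In the Hermitian product of
  two rows the diagonal entries contribute p plus its conjugate, up to sign, that is -2 or 2, which
  cancels the two products of units.\<close>

definition quat32 :: "(int \<times> int \<times> int \<times> int) list list" where
  "quat32 =
    [[(-1,-1,1,-1), (-1,0,0,0), (-1,0,0,0), (-1,0,0,0)],
     [(-1,0,0,0), (-1,-1,1,-1), (1,0,0,0), (1,0,0,0)],
     [(-1,0,0,0), (1,0,0,0), (-1,-1,1,-1), (1,0,0,0)],
     [(-1,0,0,0), (1,0,0,0), (1,0,0,0), (-1,-1,1,-1)]]"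

text \<open>The norms of the five quaternions in each row add up to 7, for example 2 + 2 + 1 + 1 + 1
  in the first.\<close>

definition quat40 :: "(int \<times> int \<times> int \<times> int) list list" where
  "quat40 =
    [[(1,0,0,1), (-1,1,0,0), (0,0,0,-1), (0,-1,0,0), (-1,0,0,0)],
     [(-1,0,0,0), (0,0,-1,1), (0,0,1,0), (0,-1,0,0), (0,1,0,-1)],
     [(-1,0,0,0), (0,0,0,0), (-1,-1,0,-1), (0,1,0,-1), (-1,0,0,0)],
     [(-1,0,0,-1), (0,0,1,0), (0,0,0,0), (0,-1,0,1), (-1,0,0,1)],
     [(-1,0,0,0), (-1,0,-1,0), (0,1,-1,0), (-1,0,0,0), (0,-1,0,0)]]"

interpretation code32: quaternionic_weighing_code 16 "\<lambda>p q. quat32 ! p ! q" "\<lambda>_. 1" 4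
proof (intro quaternionic_weighing_code.intro quaternionic_weighing_code_axioms.intro weighing_code_checkI)
  show "weighing_check (entries 16 (quat_right (\<lambda>p q. quat32 ! p ! q)))
      (entries 16 (\<lambda>i j. quat_right (\<lambda>p q. quat32 ! p ! q) j i))
      (map (\<lambda>_. 1) [0..<16]) (map (\<lambda>_. 1) [0..<16])" by code_simp
qed simp_all

text \<open>The all-one vector has norm 40, which 16 does not divide. One entry -3 gives 39 + 9 =
  48, and since -3 is 1 modulo 4, the conditions modulo 4 are the same as for the all-one
  vector.\<close>

interpretation code40: quaternionic_weighing_code 20 "\<lambda>p q. quat40 ! p ! q" "\<lambda>i. if i = 0 then -3 else 1" 5
proof (intro quaternionic_weighing_code.intro quaternionic_weighing_code_axioms.intro weighing_code_checkI)
  show "weighing_check (entries 20 (quat_right (\<lambda>p q. quat40 ! p ! q)))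
      (entries 20 (\<lambda>i j. quat_right (\<lambda>p q. quat40 ! p ! q) j i))
      (map (\<lambda>i. if i = 0 then -3 else 1) [0..<20]) (map (\<lambda>i. if 20 + i = 0 then -3 else 1) [0..<20])"
    by code_simp
qed simp_all

theorem theorem4p3:
  fixes k :: nat
  assumes "k \<ge> 1"
  shows "(\<exists>C. extremal_type_II k 32 C) \<and> (\<exists>C. extremal_type_II k 40 C)"
  using code32.extremal_exists[OF assms] code40.extremal_exists[OF assms] by simp

end
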